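(* For every positive integer $n$, $$\hat{r}(P_3,F_n)= \begin{cases}10, & \text{if } n=2;\\ 4n+4, & \text{if } n \text{ is odd};\\ 4n+5, & \text{if } n \text{ is even and } n\neq 2.\end{cases}$$
   Context: All graphs are finite and simple. For graphs $G_1,G_2$, the size Ramsey number $\hat{r}(G_1,G_2)$ is the smallest positive integer $m$ such that there exists a graph $G$ with $m$ edges with the property that for every coloring of the edges of $G$ with red and blue, $G$ contains a red subgraph isomorphic to $G_1$ or a blue subgraph isomorphic to $G_2$. $P_3$ denotes the path on $3$ vertices. The fan $F_n$ is the graph $K_1+nK_2$, i.e. $n$ disjoint edges together with one additional vertex joined to all $2n$ endpoints of these edges (so $F_n$ has $2n+1$ vertices and consists of $n$ triangles sharing exactly one common vertex). *)

theory Defs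
  imports Main
begin

type_synonym 'a graph = "'a set \<times> 'a set set"

abbreviation verts :: "'a graph \<Rightarrow> 'a set" where
  "verts G \<equiv> fst G"

abbreviation edges :: "'a graph \<Rightarrow> 'a set set" where
  "edges G \<equiv> snd G"

definition simple_graph :: "'a graph \<Rightarrow> bool" where
  "simple_graph G \<longleftrightarrow> finite (verts G) \<and> (\<forall>e\<in>edges G. e \<subseteq> verts G \<and> card e = 2)"

definition subgraph :: "'a graph \<Rightarrow> 'a graph \<Rightarrow> bool" where
  "subgraph H G \<longleftrightarrow> simple_graph H \<and> verts H \<subseteq> verts G \<and> edges H \<subseteq> edges G"

definition isomorphic :: "'a graph \<Rightarrow> 'b graph \<Rightarrow> bool" where
  "isomorphic G H \<longleftrightarrow>
     (\<exists>f. bij_betw f (verts G) (verts H) \<and>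
          (\<forall>u\<in>verts G. \<forall>v\<in>verts G. {u, v} \<in> edges G \<longleftrightarrow> {f u, f v} \<in> edges H))"

datatype colour = Red | Blue

definition colour_class :: "('a set \<Rightarrow> colour) \<Rightarrow> colour \<Rightarrow> 'a graph \<Rightarrow> 'a graph" where
  "colour_class c k G = (verts G, {e \<in> edges G. c e = k})"

definition arrows :: "'a graph \<Rightarrow> 'b graph \<Rightarrow> 'c graph \<Rightarrow> bool" where
  "arrows G G1 G2 \<longleftrightarrow>
     (\<forall>c :: 'a set \<Rightarrow> colour.
        (\<exists>H. subgraph H (colour_class c Red G) \<and> isomorphic H G1) \<or>
        (\<exists>H. subgraph H (colour_class c Blue G) \<and> isomorphic H G2))"

text \<open>Host graphs have natural numbers as vertices; this loses no generality, since every finite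
  graph is isomorphic to one of this form.\<close>

definition size_ramsey :: "'a graph \<Rightarrow> 'b graph \<Rightarrow> nat" where
  "size_ramsey G1 G2 =
     (LEAST m. 0 < m \<and>
        (\<exists>G :: nat graph. simple_graph G \<and> card (edges G) = m \<and> arrows G G1 G2))"

definition path_graph :: "nat \<Rightarrow> nat graph" where
  "path_graph k = ({0..<k}, {{i, Suc i} | i. Suc i < k})"

text \<open>In the fan, the vertex \<open>0\<close> is the centre and \<open>{2i - 1, 2i}\<close>, for \<open>1 \<le> i \<le> n\<close>, are the
  disjoint edges.\<close>

definition fan_graph :: "nat \<Rightarrow> nat graph" where
  "fan_graph n = ({0..2 * n}, {{0, j} | j. j \<in> {1..2 * n}} \<union> {{2 * i - 1, 2 * i} | i. i \<in> {1..n}})"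

lemma simple_graph_path_graph: "simple_graph (path_graph k)"
  by (auto simp: simple_graph_def path_graph_def)

lemma simple_graph_fan_graph: "simple_graph (fan_graph n)"
  by (auto simp: simple_graph_def fan_graph_def card_insert_if)

end

theory Submission imports Defs begin

text \<open>
  A colouring without a red path on three vertices is a matching of red edges, so the host graph must
  contain a fan after the deletion of any matching.

  Upper bound: for odd \<open>n\<close> take a cone over \<open>(n + 1) / 2\<close> disjoint 4-cycles, for even \<open>n\<close> a cone over
  \<open>n / 2\<close> disjoint 4-cycles and a path on three vertices, and for \<open>n = 2\<close> the complete graph on five
  vertices.

  Lower bound: a centre has degree at least \<open>2n\<close>. If two vertices have such a degree, few
  edges remain for the rim; three such vertices all have degree exactly \<open>2n\<close> and are covered by a
  red matching. If there is only one, \<open>v\<close>, consider the graph \<open>H\<close>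
  induced on its \<open>d\<close> neighbours. When \<open>d\<close> plus the number of edges of \<open>H\<close> is small, \<open>H\<close> has so many
  vertices of small degree that a red spoke \<open>{v, x}\<close> and a red matching of \<open>H - x\<close> isolate
  \<open>d - 2n\<close> of them, leaving fewer than \<open>2n\<close> vertices for the rim. The parity of \<open>n\<close> enters in the
  critical case of a 2-regular graph, which resists only if it is a union of 4-cycles. For
  \<open>n = 1\<close> a separate argument makes the graph triangle-free.
\<close>

section \<open>Red matchings and blue fans\<close>

definition matching :: "'a set set \<Rightarrow> bool" where
  "matching M \<longleftrightarrow> (\<forall>e\<in>M. \<forall>f\<in>M. e \<inter> f \<noteq> {} \<longrightarrow> e = f)"

text \<open>A fan is recorded by its centre \<open>c\<close> and its rim \<open>K\<close>. Only an
  edge set occurs, so the removal of a red matching becomes a set difference.\<close>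

definition has_fan :: "nat \<Rightarrow> 'a set set \<Rightarrow> bool" where
  "has_fan n E \<longleftrightarrow> (\<exists>c K. K \<subseteq> E \<and> card K = n \<and> matching K \<and> c \<notin> \<Union>K \<and> (\<forall>w\<in>\<Union>K. {c, w} \<in> E))"

lemma matchingD: "matching M \<Longrightarrow> e \<in> M \<Longrightarrow> f \<in> M \<Longrightarrow> v \<in> e \<Longrightarrow> v \<in> f \<Longrightarrow> e = f"
  unfolding matching_def by blast

lemma matching_subset: "matching M \<Longrightarrow> N \<subseteq> M \<Longrightarrow> matching N"
  unfolding matching_def by blast

lemma matching_if_card_le_1: "finite A \<Longrightarrow> card A \<le> 1 \<Longrightarrow> matching A"
  unfolding matching_def using card_le_Suc0_iff_eq[of A] by auto

lemma matching_singleton: "matching {e}"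
  unfolding matching_def by simp

lemma card_Union_matching:
  assumes "matching M" "finite M" "\<And>e. e \<in> M \<Longrightarrow> card e = 2"
  shows "card (\<Union>M) = 2 * card M"
proof -
  have "finite (\<Union>M)"
    using assms by (metis card.infinite finite_Union zero_neq_numeral)
  then show ?thesis
    using card_partition[of M 2] assms unfolding matching_def by metis
qed

lemma matching_Un:
  "matching K \<Longrightarrow> matching L \<Longrightarrow> \<Union>K \<inter> \<Union>L = {} \<Longrightarrow> matching (K \<union> L)"
  unfolding matching_def by blast

section \<open>From coloured copies to matchings and edge sets\<close>

text \<open>A copy need not be an induced subgraph, so an embedding only has to preserve edges.
  Conversely, the copy is the image of \<open>F\<close> with the images of its edges and no
  others.\<close>

lemma copy_iff_embedding:
  assumes F: "simple_graph F"
  shows "(\<exists>H. subgraph H G \<and> isomorphic H F) \<longleftrightarrow>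
    (\<exists>g. inj_on g (verts F) \<and> g ` verts F \<subseteq> verts G \<and> (\<forall>e\<in>edges F. g ` e \<in> edges G))"
    (is "?L \<longleftrightarrow> ?R")
proof
  assume ?L
  then obtain H f where H: "subgraph H G" and f: "bij_betw f (verts H) (verts F)"
    and fe: "\<forall>u\<in>verts H. \<forall>v\<in>verts H. {u, v} \<in> edges H \<longleftrightarrow> {f u, f v} \<in> edges F"
    unfolding isomorphic_def by blast
  define g where "g = inv_into (verts H) f"
  have g: "bij_betw g (verts F) (verts H)"
    using f g_def bij_betw_inv_into by blast
  have fg: "f (g a) = a" if "a \<in> verts F" for a
    using that f unfolding g_def by (metis bij_betw_inv_into_right)
  have gH: "g a \<in> verts H" if "a \<in> verts F" for a
    using that g by (meson bij_betwE)
  have "g ` e \<in> edges G" if e: "e \<in> edges F" for e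
  proof -
    obtain a b where ab: "e = {a, b}" "a \<in> verts F" "b \<in> verts F"
      using e F unfolding simple_graph_def by (metis card_2_iff insert_subset)
    then have "{g a, g b} \<in> edges H"
      using fe e fg gH by simp
    then show ?thesis using H ab unfolding subgraph_def by auto
  qed
  then show ?R
    using g H unfolding subgraph_def bij_betw_def by (intro exI[of _ g]) simp
next
  assume ?R
  then obtain g where inj: "inj_on g (verts F)" and sub: "g ` verts F \<subseteq> verts G"
    and ge: "\<forall>e\<in>edges F. g ` e \<in> edges G" by blast
  define H where "H = (g ` verts F, (`) g ` edges F)"
  have Fe: "e \<subseteq> verts F" "card e = 2" if "e \<in> edges F" for e
    using that F unfolding simple_graph_def by auto
  have "simple_graph H"
    using F Fe inj unfolding simple_graph_def H_def
    by (auto simp: card_image inj_on_subset)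
  then have "subgraph H G"
    using sub ge unfolding subgraph_def H_def by auto
  moreover have "isomorphic H F"
    unfolding isomorphic_def
  proof (intro exI conjI ballI)
    show "bij_betw (inv_into (verts F) g) (verts H) (verts F)"
      using bij_betw_inv_into[OF inj_on_imp_bij_betw[OF inj]] unfolding H_def by simp
    fix u v assume "u \<in> verts H" "v \<in> verts H"
    then obtain a b where ab: "u = g a" "v = g b" "a \<in> verts F" "b \<in> verts F"
      unfolding H_def by auto
    have "{u, v} = g ` {a, b}" using ab by simp
    then have "{u, v} \<in> edges H \<longleftrightarrow> (\<exists>e\<in>edges F. g ` {a, b} = g ` e)"
      unfolding H_def by auto
    also have "\<dots> \<longleftrightarrow> {a, b} \<in> edges F"
      using inj_on_image_eq_iff[OF inj] Fe ab by (metis empty_subsetI insert_subset)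
    finally show "{u, v} \<in> edges H \<longleftrightarrow>
        {inv_into (verts F) g u, inv_into (verts F) g v} \<in> edges F"
      using ab inj by simp
  qed
  ultimately show ?L by blast
qed

lemma fan_copy_iff:
  assumes G: "simple_graph G" and n: "n > 0"
  shows "(\<exists>H. subgraph H G \<and> isomorphic H (fan_graph n)) \<longleftrightarrow> has_fan n (edges G)"
  unfolding copy_iff_embedding[OF simple_graph_fan_graph]
proof
  assume "\<exists>g. inj_on g (verts (fan_graph n)) \<and> g ` verts (fan_graph n) \<subseteq> verts G \<and>
    (\<forall>e\<in>edges (fan_graph n). g ` e \<in> edges G)"
  then obtain g where inj: "inj_on g {0..2*n}" and
    ge: "\<forall>e\<in>edges (fan_graph n). g ` e \<in> edges G" by (auto simp: fan_graph_def)
  have spoke: "{g 0, g j} \<in> edges G" if "j \<in> {1..2*n}" for j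
    using ge[rule_format, of "{0, j}"] that by (auto simp: fan_graph_def)
  have rim: "{g (2*i-1), g (2*i)} \<in> edges G" if "i \<in> {1..n}" for i
    using ge[rule_format, of "{2*i-1, 2*i}"] that by (auto simp: fan_graph_def)
  have eq: "g i = g j \<longleftrightarrow> i = j" if "i \<le> 2*n" "j \<le> 2*n" for i j
    using inj that by (auto simp: inj_on_def)
  define K where "K = (\<lambda>i. {g (2*i-1), g (2*i)}) ` {1..n}"
  have "inj_on (\<lambda>i. {g (2*i-1), g (2*i)}) {1..n}"
    by (rule inj_onI) (auto simp: doubleton_eq_iff eq)
  then have "card K = n" unfolding K_def by (simp add: card_image)
  moreover have "matching K"
    unfolding matching_def K_def
  proof (intro ballI impI, elim imageE)
    fix e f i j assume h: "e = {g (2*i-1), g (2*i)}" "f = {g (2*j-1), g (2*j)}"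
      "i \<in> {1..n}" "j \<in> {1..n}" "e \<inter> f \<noteq> {}"
    then have "2*i-1 = 2*j-1 \<or> 2*i-1 = 2*j \<or> 2*i = 2*j-1 \<or> 2*i=2*j"
      by (auto simp: eq)
    then have "i = j" using h(3,4) by (auto; presburger)
    then show "e = f" using h by simp
  qed
  moreover have "K \<subseteq> edges G" using rim by (auto simp: K_def)
  moreover have "g 0 \<notin> \<Union>K" unfolding K_def by (auto simp: eq)
  moreover have "\<forall>w\<in>\<Union>K. {g 0, w} \<in> edges G"
    unfolding K_def using spoke by (fastforce intro!: spoke)
  ultimately show "has_fan n (edges G)" unfolding has_fan_def by blast
next
  assume "has_fan n (edges G)"
  then obtain c K where K: "K \<subseteq> edges G" "card K = n" "matching K" "c \<notin> \<Union>K"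
    "\<forall>w\<in>\<Union>K. {c, w} \<in> edges G" unfolding has_fan_def by blast
  have "finite K" using K(2) n card.infinite by fastforce
  then obtain h where h: "bij_betw h {1..n} K"
    using K(2) by (metis ex_bij_betw_nat_finite_1)
  have hK: "h i \<in> K" if "i \<in> {1..n}" for i using h that by (meson bij_betwE)
  have "\<exists>p q. h i = {p, q} \<and> p \<noteq> q" if "i \<in> {1..n}" for i
    using hK[OF that] K(1) G unfolding simple_graph_def by (meson card_2_iff subsetD)
  then obtain a b where ab: "\<And>i. i \<in> {1..n} \<Longrightarrow> h i = {a i, b i} \<and> a i \<noteq> b i"
    by metis
  \<comment> \<open>The labels 2i - 1 and 2i go to the two ends of the rim edge \<open>h i\<close>.
    Thus \<open>Suc j div 2\<close> is the index of the rim edge containing \<open>g j\<close>, and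
    the parity of \<open>j\<close> tells its ends apart.\<close>
  define g where "g j = (if j = 0 then c else if odd j then a (Suc j div 2) else b (j div 2))" for j
  have g_mem: "g j \<in> h (Suc j div 2)" "Suc j div 2 \<in> {1..n}" if "j \<in> {1..2*n}" for j
  proof -
    show i: "Suc j div 2 \<in> {1..n}" using that by auto
    show "g j \<in> h (Suc j div 2)"
      using ab[OF i] that by (auto simp: g_def)
  qed
  have g_K: "g j \<in> \<Union>K" if "j \<in> {1..2*n}" for j
    using g_mem[OF that] hK by blast
  have "inj_on g {0..2*n}"
  proof (rule inj_onI)
    fix i j assume ij: "i \<in> {0..2*n}" "j \<in> {0..2*n}" "g i = g j"
    show "i = j"
    proof (cases "i = 0 \<or> j = 0")
      case True
      then show ?thesis using ij K(4) g_K[of i] g_K[of j]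
        by (metis atLeastAtMost_iff g_def less_one linorder_not_less)
    next
      case False
      then have r: "i \<in> {1..2*n}" "j \<in> {1..2*n}" using ij by auto
      have "h (Suc i div 2) = h (Suc j div 2)"
        using g_mem[OF r(1)] g_mem[OF r(2)] hK ij(3) K(3) unfolding matching_def
        by (metis disjoint_iff)
      then have e: "Suc i div 2 = Suc j div 2"
        using h g_mem[OF r(1)] g_mem[OF r(2)] unfolding bij_betw_def inj_on_def by blast
      have "even i = even j"
        using e ij(3) False ab[OF g_mem(2)[OF r(1)]]
        by (auto simp: g_def split: if_splits)
      then show ?thesis using e by presburger
    qed
  qed
  moreover have edge: "g ` e \<in> edges G" if "e \<in> edges (fan_graph n)" for e
  proof -
    from that consider j where "e = {0, j}" "j \<in> {1..2*n}"
      | i where "e = {2*i-1, 2*i}" "i \<in> {1..n}" by (auto simp: fan_graph_def)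
    then show ?thesis
    proof cases
      case 1
      have "g ` e = {c, g j}" using 1 by (simp add: g_def)
      then show ?thesis using K(5) g_K[OF 1(2)] by auto
    next
      case 2
      then have "g ` e = h i" using ab[OF 2(2)] by (auto simp: g_def)
      then show ?thesis using hK 2 K by auto
    qed
  qed
  moreover have "g j \<in> verts G" if "j \<in> {0..2*n}" for j
  proof -
    \<comment> \<open>For the centre label 0 this is the edge \<open>{0, 1}\<close>, which exists
      because n > 0.\<close>
    have "{0, max j 1} \<in> edges (fan_graph n)"
      using that n by (auto simp: fan_graph_def)
    from edge[OF this] have "g ` {0, max j 1} \<subseteq> verts G"
      using G unfolding simple_graph_def by (metis (no_types))
    then show ?thesis by (cases "j = 0") (auto simp: max_absorb1)
  qed
  ultimately show "\<exists>g. inj_on g (verts (fan_graph n)) \<and> g ` verts (fan_graph n) \<subseteq> verts G \<and>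
    (\<forall>e\<in>edges (fan_graph n). g ` e \<in> edges G)"
    by (intro exI[of _ g]) (auto simp: fan_graph_def)
qed

text \<open>Distinct edges of a simple graph that meet share exactly one vertex, hence form a path
  on three vertices.\<close>

lemma path_copy_iff:
  assumes G: "simple_graph G"
  shows "(\<exists>H. subgraph H G \<and> isomorphic H (path_graph 3)) \<longleftrightarrow> \<not> matching (edges G)"
  unfolding copy_iff_embedding[OF simple_graph_path_graph]
proof
  have E: "edges (path_graph 3) = {{0, 1}, {1, 2}}"
    unfolding path_graph_def by (auto simp: less_Suc_eq numeral_3_eq_3)
  {
    assume "\<exists>g. inj_on g (verts (path_graph 3)) \<and> g ` verts (path_graph 3) \<subseteq> verts G \<and>
      (\<forall>e\<in>edges (path_graph 3). g ` e \<in> edges G)"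
    then obtain g where g: "inj_on g {0..<3::nat}" "{g 0, g 1} \<in> edges G" "{g 1, g 2} \<in> edges G"
      unfolding E by (auto simp: path_graph_def)
    have "g 0 \<noteq> g 1" "g 0 \<noteq> g 2"
      using inj_onD[OF g(1), of 0 1] inj_onD[OF g(1), of 0 2] by auto
    then show "\<not> matching (edges G)"
      using g unfolding matching_def by (fastforce simp: doubleton_eq_iff)
  next
    assume "\<not> matching (edges G)"
    then obtain e f v where ef: "e \<in> edges G" "f \<in> edges G" "v \<in> e" "v \<in> f" "e \<noteq> f"
      unfolding matching_def by blast
    obtain u w where uw: "e = {u, v}" "f = {v, w}" "u \<noteq> v" "w \<noteq> v"
      using ef G unfolding simple_graph_def
      by (metis card_2_iff doubleton_eq_iff insertE singletonD)
    have "u \<noteq> w" using uw ef by auto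
    define g where "g = (\<lambda>i::nat. if i = 0 then u else if i = 1 then v else w)"
    have "inj_on g {0..<3}" using uw \<open>u \<noteq> w\<close> by (auto simp: inj_on_def g_def)
    moreover have "g ` {0..<3} \<subseteq> verts G"
      using uw ef G unfolding simple_graph_def g_def by auto
    ultimately show "\<exists>g. inj_on g (verts (path_graph 3)) \<and> g ` verts (path_graph 3) \<subseteq> verts G \<and>
      (\<forall>e\<in>edges (path_graph 3). g ` e \<in> edges G)"
      using uw ef unfolding E
      by (intro exI[of _ g] conjI) (simp_all add: path_graph_def g_def insert_commute)
  }
qed

text \<open>Only the red class of a colouring matters, and every set of edges is the red class of
  some colouring. From here on matchings \<open>M\<close> of red edges replace colourings.\<close>

lemma arrows_iff:
  assumes G: "simple_graph G" and n: "n > 0"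
  shows "arrows G (path_graph 3) (fan_graph n) \<longleftrightarrow>
    (\<forall>M\<subseteq>edges G. matching M \<longrightarrow> has_fan n (edges G - M))"
proof -
  have simple: "simple_graph (colour_class c k G)" for c k
    using G by (auto simp: simple_graph_def colour_class_def)
  have "arrows G (path_graph 3) (fan_graph n) \<longleftrightarrow>
    (\<forall>c. matching {e \<in> edges G. c e = Red} \<longrightarrow> has_fan n {e \<in> edges G. c e = Blue})"
    unfolding arrows_def path_copy_iff[OF simple] fan_copy_iff[OF simple n]
    by (auto simp: colour_class_def)
  also have "\<dots> \<longleftrightarrow> (\<forall>M\<subseteq>edges G. matching M \<longrightarrow> has_fan n (edges G - M))"
  proof (intro iffI allI impI)
    fix M assume h: "\<forall>c. matching {e \<in> edges G. c e = Red} \<longrightarrow> has_fan n {e \<in> edges G. c e = Blue}"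
      and M: "M \<subseteq> edges G" "matching M"
    have "{e \<in> edges G. (if e \<in> M then Red else Blue) = Red} = M"
      "{e \<in> edges G. (if e \<in> M then Red else Blue) = Blue} = edges G - M"
      using M by auto
    then show "has_fan n (edges G - M)"
      using h[rule_format, of "\<lambda>e. if e \<in> M then Red else Blue"] M by simp
  next
    fix c assume h: "\<forall>M\<subseteq>edges G. matching M \<longrightarrow> has_fan n (edges G - M)"
      and c: "matching {e \<in> edges G. c e = Red}"
    have "{e \<in> edges G. c e = Blue} = edges G - {e \<in> edges G. c e = Red}"
      by (auto intro: colour.exhaust)
    then show "has_fan n {e \<in> edges G. c e = Blue}" using h c by simp
  qed
  finally show ?thesis .
qed

section \<open>Host graphs\<close>

text \<open>In a host graph that is a cone over \<open>E\<close>, the vertex \<open>x\<close> is the end of the only spoke that may be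
  red.\<close>

definition robust :: "nat \<Rightarrow> 'a set set \<Rightarrow> bool" where
  "robust t E \<longleftrightarrow> (\<forall>M. matching M \<longrightarrow>
     (\<exists>K\<subseteq>E - M. matching K \<and> finite K \<and> t \<le> card K) \<and>
     (\<forall>x. \<exists>K\<subseteq>E - M. matching K \<and> finite K \<and> t \<le> card K + 1 \<and> x \<notin> \<Union>K))"

text \<open>The vertex \<open>x\<close> lies on at most one of the two parts, so at most one part
  has to give up an edge; the other contributes its full matching from the first clause of
  \<open>robust\<close>. Since \<open>{}\<close> is not an edge of \<open>E\<close>, disjoint vertex
  sets make the two matchings disjoint.\<close>

lemma robust_Un:
  assumes E: "robust s E" and F: "robust t F" and disj: "\<Union>E \<inter> \<Union>F = {}" and ne: "{} \<notin> E"
  shows "robust (s + t) (E \<union> F)"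
  unfolding robust_def
proof (intro allI impI)
  fix M :: "'a set set" assume M: "matching M"
  have join: "matching (K \<union> L)" "finite (K \<union> L)" "card (K \<union> L) = card K + card L"
    if "K \<subseteq> E - M" "L \<subseteq> F - M" "matching K" "matching L" "finite K" "finite L" for K L
  proof -
    have u: "\<Union>K \<inter> \<Union>L = {}" using that disj by blast
    show "matching (K \<union> L)" using that matching_Un u by blast
    show "finite (K \<union> L)" using that by simp
    have "K \<inter> L = {}"
    proof (rule ccontr)
      assume "K \<inter> L \<noteq> {}"
      then obtain e where "e \<in> K" "e \<in> L" by blast
      then have "e = {}" using u by blast
      then show False using ne that \<open>e \<in> K\<close> by blast
    qed
    then show "card (K \<union> L) = card K + card L" using that by (simp add: card_Un_disjoint)
  qed
  obtain K0 where K0: "K0 \<subseteq> E - M" "matching K0" "finite K0" "s \<le> card K0"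
    using E M unfolding robust_def by meson
  obtain L0 where L0: "L0 \<subseteq> F - M" "matching L0" "finite L0" "t \<le> card L0"
    using F M unfolding robust_def by meson
  show "(\<exists>K\<subseteq>E \<union> F - M. matching K \<and> finite K \<and> s + t \<le> card K) \<and>
    (\<forall>x. \<exists>K\<subseteq>E \<union> F - M. matching K \<and> finite K \<and> s + t \<le> card K + 1 \<and> x \<notin> \<Union>K)"
  proof (intro conjI allI)
    show "\<exists>K\<subseteq>E \<union> F - M. matching K \<and> finite K \<and> s + t \<le> card K"
      using join[OF K0(1) L0(1) K0(2) L0(2) K0(3) L0(3)] K0 L0
      by (intro exI[of _ "K0 \<union> L0"]) auto
    fix x
    obtain K1 where K1: "K1 \<subseteq> E - M" "matching K1" "finite K1" "s \<le> card K1 + 1" "x \<notin> \<Union>K1"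
      using E M unfolding robust_def by meson
    obtain L1 where L1: "L1 \<subseteq> F - M" "matching L1" "finite L1" "t \<le> card L1 + 1" "x \<notin> \<Union>L1"
      using F M unfolding robust_def by meson
    show "\<exists>K\<subseteq>E \<union> F - M. matching K \<and> finite K \<and> s + t \<le> card K + 1 \<and> x \<notin> \<Union>K"
    proof (cases "x \<in> \<Union>E")
      case True
      then have "x \<notin> \<Union>L0" using disj L0 by blast
      then show ?thesis
        using join[OF K1(1) L0(1) K1(2) L0(2) K1(3) L0(3)] K1 L0
        by (intro exI[of _ "K1 \<union> L0"]) auto
    next
      case False
      then have "x \<notin> \<Union>K0" using K0 by blast
      then show ?thesis
        using join[OF K0(1) L1(1) K0(2) L1(2) K0(3) L1(3)] K0 L1
        by (intro exI[of _ "K0 \<union> L1"]) auto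
    qed
  qed
qed

section \<open>Four-cycles and short paths as rims\<close>

definition four_cycle :: "'a \<Rightarrow> 'a \<Rightarrow> 'a \<Rightarrow> 'a \<Rightarrow> 'a set set" where
  "four_cycle a b c d = {{a, b}, {b, c}, {c, d}, {d, a}}"

text \<open>Consecutive edges are not both in \<open>M\<close>, so \<open>M\<close> misses one of
  the two perfect matchings of the cycle. For every \<open>x\<close> some two consecutive edges
  avoid \<open>x\<close>, and one of them is not in \<open>M\<close>.\<close>

lemma robust_four_cycle:
  assumes "distinct [a, b, c, d]"
  shows "robust 2 (four_cycle a b c d)"
  unfolding robust_def
proof (intro allI impI conjI)
  fix M :: "'a set set" assume M: "matching M"
  have one: "e \<notin> M \<or> f \<notin> M" if "e \<noteq> f" "v \<in> e" "v \<in> f" for e f v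
    using M that unfolding matching_def by blast
  have pair: "matching {e, f}" if "e \<inter> f = {}" for e f :: "'a set"
    using that unfolding matching_def by blast
  have ne: "{a,b} \<noteq> {b,c}" "{b,c} \<noteq> {c,d}" "{c,d} \<noteq> {d,a}" "{d,a} \<noteq> {a,b}"
    "{a,b} \<noteq> {c,d}" "{b,c} \<noteq> {d,a}"
    using assms by (auto simp: doubleton_eq_iff)
  have adj: "{a,b} \<notin> M \<or> {b,c} \<notin> M" "{b,c} \<notin> M \<or> {c,d} \<notin> M"
    "{c,d} \<notin> M \<or> {d,a} \<notin> M" "{d,a} \<notin> M \<or> {a,b} \<notin> M"
    using one[OF ne(1), of b] one[OF ne(2), of c] one[OF ne(3), of d] one[OF ne(4), of a] by auto
  have "{a,b} \<notin> M \<and> {c,d} \<notin> M \<or> {b,c} \<notin> M \<and> {d,a} \<notin> M" using adj by blast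
  then show "\<exists>K\<subseteq>four_cycle a b c d - M. matching K \<and> finite K \<and> 2 \<le> card K"
  proof
    assume "{a,b} \<notin> M \<and> {c,d} \<notin> M"
    then show ?thesis using ne(5) pair[of "{a,b}" "{c,d}"] assms
      by (intro exI[of _ "{{a,b},{c,d}}"]) (auto simp: four_cycle_def)
  next
    assume "{b,c} \<notin> M \<and> {d,a} \<notin> M"
    then show ?thesis using ne(6) pair[of "{b,c}" "{d,a}"] assms
      by (intro exI[of _ "{{b,c},{d,a}}"]) (auto simp: four_cycle_def)
  qed
  fix x
  have "\<exists>e\<in>four_cycle a b c d - M. x \<notin> e"
  proof -
    have sel: "\<exists>e\<in>four_cycle a b c d - M. x \<notin> e"
      if "e \<in> four_cycle a b c d" "f \<in> four_cycle a b c d" "e \<notin> M \<or> f \<notin> M" "x \<notin> e" "x \<notin> f" for e f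
      using that by blast
    consider "x \<noteq> a" "x \<noteq> b" "x \<noteq> c" | "x = a" | "x = b" | "x = c" by blast
    then show ?thesis
    proof cases
      case 1 then show ?thesis using sel[OF _ _ adj(1)] assms by (auto simp: four_cycle_def)
    next
      case 2 then show ?thesis using sel[OF _ _ adj(2)] assms by (auto simp: four_cycle_def)
    next
      case 3 then show ?thesis using sel[OF _ _ adj(3)] assms by (auto simp: four_cycle_def)
    next
      case 4 then show ?thesis using sel[OF _ _ adj(4)] assms by (auto simp: four_cycle_def)
    qed
  qed
  then obtain e where "e \<in> four_cycle a b c d - M" "x \<notin> e" by blast
  then show "\<exists>K\<subseteq>four_cycle a b c d - M. matching K \<and> finite K \<and> 2 \<le> card K + 1 \<and> x \<notin> \<Union>K"
    by (intro exI[of _ "{e}"]) (auto simp: matching_singleton)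
qed

lemma robust_path:
  assumes "a \<noteq> c"
  shows "robust 1 {{a, b}, {b, c}}"
  unfolding robust_def
proof (intro allI impI conjI)
  fix M :: "'a set set" assume M: "matching M"
  have "{a, b} \<notin> M \<or> {b, c} \<notin> M"
    using matchingD[OF M, of "{a, b}" "{b, c}" b] assms by (auto simp: doubleton_eq_iff)
  then obtain e where "e \<in> {{a, b}, {b, c}} - M" by blast
  then show "\<exists>K\<subseteq>{{a, b}, {b, c}} - M. matching K \<and> finite K \<and> 1 \<le> card K"
    by (intro exI[of _ "{e}"]) (auto simp: matching_singleton)
  show "\<exists>K\<subseteq>{{a, b}, {b, c}} - M. matching K \<and> finite K \<and> 1 \<le> card K + 1 \<and> x \<notin> \<Union>K" for x
    by (intro exI[of _ "{}"]) (auto simp: matching_def)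
qed

definition four_cycles :: "nat \<Rightarrow> nat set set" where
  "four_cycles q = (\<Union>i<q. four_cycle (4*i+1) (4*i+2) (4*i+3) (4*i+4))"

lemma four_cycles_edge: "e \<in> four_cycles q \<Longrightarrow> e \<subseteq> {1..4*q} \<and> card e = 2"
  unfolding four_cycles_def four_cycle_def by auto

lemma robust_four_cycles: "robust (2 * q) (four_cycles q)"
proof (induction q)
  case 0
  show ?case
    by (auto simp: robust_def four_cycles_def matching_def)
next
  case (Suc q)
  let ?C = "four_cycle (4*q+1) (4*q+2) (4*q+3) (4*q+4)"
  have "\<Union>(four_cycles q) \<subseteq> {1..4*q}" using four_cycles_edge by blast
  moreover have "\<Union>?C \<inter> {1..4*q} = {}" by (auto simp: four_cycle_def)
  moreover have "{} \<notin> ?C" by (auto simp: four_cycle_def)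
  moreover have "robust 2 ?C" by (rule robust_four_cycle) simp
  ultimately have "robust (2 + 2 * q) (?C \<union> four_cycles q)"
    using robust_Un[OF _ Suc.IH] by blast
  moreover have "?C \<union> four_cycles q = four_cycles (Suc q)"
    unfolding four_cycles_def by (simp add: lessThan_Suc)
  ultimately show ?case by simp
qed

lemma card_four_cycles_le: "card (four_cycles q) \<le> 4 * q"
proof -
  have "card (four_cycle a b c d) \<le> 4" for a b c d :: nat
    unfolding four_cycle_def by (simp add: card_insert_if)
  then have "(\<Sum>i<q. card (four_cycle (4*i+1) (4*i+2) (4*i+3) (4*i+4))) \<le> (\<Sum>i<q. 4)"
    by (intro sum_mono) blast
  moreover have "card (four_cycles q) \<le> (\<Sum>i<q. card (four_cycle (4*i+1) (4*i+2) (4*i+3) (4*i+4)))"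
    unfolding four_cycles_def by (rule card_UN_le) simp
  ultimately show ?thesis by simp
qed

section \<open>Cones and the complete graph as host graphs\<close>

text \<open>A red matching contains at most one spoke \<open>{0, x}\<close>. Robustness n + 1 yields
  n blue rim edges that avoid \<open>x\<close>, and the spokes to their ends are blue. If no spoke
  is red, any \<open>x\<close> serves.\<close>

lemma cone_arrows:
  fixes H :: "nat set set"
  assumes H: "\<And>e. e \<in> H \<Longrightarrow> e \<subseteq> {1..d} \<and> card e = 2" and r: "robust (n + 1) H" and n: "n > 0"
  defines "G \<equiv> ({0..d}, (\<lambda>j. {0, j}) ` {1..d} \<union> H)"
  shows "simple_graph G" "card (edges G) \<le> d + card H" "arrows G (path_graph 3) (fan_graph n)"
proof -
  have Hd: "e \<subseteq> {0..d}" if "e \<in> H" for e using H[OF that] by auto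
  show simple: "simple_graph G"
    using H Hd unfolding G_def simple_graph_def by auto
  have "card ((\<lambda>j. {0, j}) ` {1..d}) \<le> d"
    using card_image_le[of "{1..d}" "\<lambda>j. {0, j}"] by simp
  then show "card (edges G) \<le> d + card H"
    unfolding G_def using card_Un_le[of "(\<lambda>j. {0, j}) ` {1..d}" H] by simp
  show "arrows G (path_graph 3) (fan_graph n)"
    unfolding arrows_iff[OF simple n]
  proof (intro allI impI)
    fix M assume M: "M \<subseteq> edges G" "matching M"
    obtain x where x: "\<And>y. {0, y} \<in> M \<Longrightarrow> y = x"
    proof (cases "\<exists>x. {0, x} \<in> M")
      case True
      then obtain x where "{0, x} \<in> M" by blast
      then have "{0, y} = {0, x}" if "{0, y} \<in> M" for y
        using matchingD[OF M(2) that, of _ 0] by simp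
      then show ?thesis using that[of x] by (auto simp: doubleton_eq_iff)
    qed (use that in blast)
    obtain K where K: "K \<subseteq> H - M" "matching K" "finite K" "n + 1 \<le> card K + 1" "x \<notin> \<Union>K"
      using r M(2) unfolding robust_def by meson
    then have "n \<le> card K" by simp
    then obtain L where L: "L \<subseteq> K" "card L = n"
      by (meson obtain_subset_with_card_n)
    have sub: "\<Union>L \<subseteq> {1..d}" using L K H by blast
    show "has_fan n (edges G - M)"
      unfolding has_fan_def
    proof (intro exI conjI)
      show "L \<subseteq> edges G - M" using L K unfolding G_def by auto
      show "card L = n" "matching L" using L K matching_subset by auto
      show "0 \<notin> \<Union>L" using sub by auto
      show "\<forall>w\<in>\<Union>L. {0, w} \<in> edges G - M"
      proof
        fix w assume w: "w \<in> \<Union>L"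
        then have "w \<noteq> x" using K L by blast
        then show "{0, w} \<in> edges G - M" using x w sub unfolding G_def by auto
      qed
    qed
  qed
qed

text \<open>A matching covers an even number of vertices, so one of the five, \<open>c\<close>, lies
  on no red edge. The other four carry a 4-cycle, which keeps two disjoint blue edges for the
  rim.\<close>

lemma K5_arrows_F2:
  defines "G \<equiv> ({0..<5::nat}, {e. e \<subseteq> {0..<5} \<and> card e = 2})"
  shows "simple_graph G" "card (edges G) \<le> 10" "arrows G (path_graph 3) (fan_graph 2)"
proof -
  show simple: "simple_graph G" unfolding G_def simple_graph_def by simp
  show "card (edges G) \<le> 10"
    using n_subsets[of "{0..<5::nat}" 2] unfolding G_def by (simp add: choose_two)
  have two: "(0::nat) < 2" by simp
  show "arrows G (path_graph 3) (fan_graph 2)"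
    unfolding arrows_iff[OF simple two]
  proof (intro allI impI)
    fix M assume M: "M \<subseteq> edges G" "matching M"
    have M2: "e \<subseteq> {0..<5}" "card e = 2" if "e \<in> M" for e
      using that M unfolding G_def by auto
    have "finite M" using M unfolding G_def
      by (rule_tac finite_subset[of _ "Pow {0..<5}"]) auto
    then have "card (\<Union>M) = 2 * card M" using card_Union_matching M(2) M2 by blast
    then have "\<Union>M \<noteq> {0..<5}" by (metis card_atLeastLessThan diff_zero even_mult_iff even_numeral odd_numeral)
    then obtain c where c: "c \<in> {0..<5}" "c \<notin> \<Union>M" using M2 by blast
    obtain xs where xs: "set xs = {0..<5} - {c}" "distinct xs"
      by (metis finite_atLeastLessThan finite_Diff finite_distinct_list)
    then have "length xs = 4" using c distinct_card[of xs] by simp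
    then obtain p q r s where "xs = [p, q, r, s]"
      by (auto simp: numeral_eq_Suc length_Suc_conv)
    then have d: "distinct [p, q, r, s]" and S: "{p, q, r, s} = {0..<5} - {c}" using xs by auto
    obtain K where K: "K \<subseteq> four_cycle p q r s - M" "matching K" "finite K" "2 \<le> card K"
      using robust_four_cycle[OF d] M unfolding robust_def by meson
    obtain L where L: "L \<subseteq> K" "card L = 2"
      using K by (meson obtain_subset_with_card_n)
    have C: "e \<subseteq> {0..<5} - {c} \<and> card e = 2" if "e \<in> four_cycle p q r s" for e
      using that d unfolding S[symmetric] four_cycle_def by auto
    have sub: "\<Union>L \<subseteq> {0..<5} - {c}" using L K C by blast
    show "has_fan 2 (edges G - M)"
      unfolding has_fan_def
    proof (intro exI conjI)
      show "L \<subseteq> edges G - M" using L K C unfolding G_def by fastforce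
      show "card L = 2" "matching L" using L K matching_subset by auto
      show "c \<notin> \<Union>L" using sub by auto
      show "\<forall>w\<in>\<Union>L. {c, w} \<in> edges G - M"
      proof
        fix w assume "w \<in> \<Union>L"
        then have "w \<in> {0..<5}" "w \<noteq> c" using sub by auto
        then show "{c, w} \<in> edges G - M" using c unfolding G_def by auto
      qed
    qed
  qed
qed

text \<open>Only an upper bound on the number of edges of the host graph is needed: the lower bound forces
  equality.\<close>

lemma fan_upper_bound:
  assumes n: "n > 0"
  shows "\<exists>G :: nat graph. simple_graph G \<and> arrows G (path_graph 3) (fan_graph n) \<and>
    card (edges G) \<le> (if n = 2 then 10 else if odd n then 4 * n + 4 else 4 * n + 5)"
proof -
  consider "n = 2" | "odd n" | "even n" "n \<noteq> 2" by blast
  then show ?thesis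
  proof cases
    case 1
    then show ?thesis using K5_arrows_F2 by (intro exI conjI) auto
  next
    case 2
    \<comment> \<open>Robustness is 2q = n + 1; 4q spokes and at most 4q rim edges make at most 8q =
      4n + 4.\<close>
    define q where "q = (n + 1) div 2"
    have q: "2 * q = n + 1" using 2 unfolding q_def by auto
    have r: "robust (n + 1) (four_cycles q)" using robust_four_cycles[of q] q by simp
    have "4 * q + card (four_cycles q) \<le> 4 * n + 4" using card_four_cycles_le[of q] q by simp
    then show ?thesis
      using cone_arrows[OF four_cycles_edge[of _ q] r n] 2 by (intro exI conjI) auto
  next
    case 3
    define q where "q = n div 2"
    have q: "2 * q = n" using 3 unfolding q_def by auto
    \<comment> \<open>Here 2q = n, and the path on three new vertices supplies the missing unit of
      robustness. The 4q + 3 spokes and at most 4q + 2 other edges make at most 4n + 5.\<close>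
    define H where "H = four_cycles q \<union> {{4*q+1, 4*q+2}, {4*q+2, 4*q+3}}"
    have H: "e \<subseteq> {1..4*q+3} \<and> card e = 2" if "e \<in> H" for e
      using that four_cycles_edge[of e q] unfolding H_def by fastforce
    have "\<Union>(four_cycles q) \<subseteq> {1..4*q}" "{} \<notin> four_cycles q"
      using four_cycles_edge by fastforce+
    then have "robust (2 * q + 1) H"
      unfolding H_def
      by (intro robust_Un robust_four_cycles robust_path) fastforce+
    then have r: "robust (n + 1) H" using q by simp
    have "card H \<le> card (four_cycles q) + card {{4*q+1, 4*q+2}, {4*q+2, 4*q+3}}"
      unfolding H_def by (rule card_Un_le)
    also have "\<dots> \<le> 4 * q + 2"
      using card_four_cycles_le[of q] card_insert_le_m1 by (simp add: card_insert_if)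
    finally have "4 * q + 3 + card H \<le> 4 * n + 5" using q by simp
    then show ?thesis
      using cone_arrows[OF H r n] 3 by (intro exI conjI) auto
  qed
qed

section \<open>Isolating vertices by a matching and one vertex\<close>

locale finite_graph =
  fixes V :: "'a set" and E :: "'a set set"
  assumes finite_V: "finite V"
    and edge_subset: "e \<in> E \<Longrightarrow> e \<subseteq> V"
    and edge_card: "e \<in> E \<Longrightarrow> card e = 2"
begin

definition inc :: "'a \<Rightarrow> 'a set set" where "inc v = {e \<in> E. v \<in> e}"

definition deg :: "'a \<Rightarrow> nat" where "deg v = card (inc v)"

definition nbrs :: "'a \<Rightarrow> 'a set" where "nbrs v = {w. {v, w} \<in> E}"

lemma finite_E: "finite E"
  using finite_V edge_subset by (meson Pow_iff finite_Pow_iff finite_subset subsetI)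

lemma finite_inc: "finite (inc v)"
  unfolding inc_def using finite_E by simp

lemma edgeE:
  assumes "e \<in> E" "v \<in> e"
  obtains w where "e = {v, w}" "w \<noteq> v" "w \<in> V" "v \<in> V"
proof -
  obtain a b where "e = {a, b}" "a \<noteq> b" using edge_card[OF assms(1)] by (auto simp: card_2_iff)
  then show ?thesis using that assms edge_subset[OF assms(1)] by auto
qed

lemma nbrs_subset: "nbrs v \<subseteq> V" "finite (nbrs v)"
proof -
  show "nbrs v \<subseteq> V" using edge_subset unfolding nbrs_def by blast
  then show "finite (nbrs v)" using finite_V finite_subset by blast
qed

lemma not_in_nbrs: "v \<notin> nbrs v"
  using edge_card[of "{v}"] unfolding nbrs_def by auto

lemma nbrs_sym: "u \<in> nbrs v \<longleftrightarrow> v \<in> nbrs u"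
  unfolding nbrs_def by (simp add: insert_commute)

lemma inc_eq: "inc v = (\<lambda>w. {v, w}) ` nbrs v"
proof
  show "inc v \<subseteq> (\<lambda>w. {v, w}) ` nbrs v"
  proof
    fix e assume "e \<in> inc v"
    then have e: "e \<in> E" "v \<in> e" unfolding inc_def by auto
    then obtain w where "e = {v, w}" by (meson edgeE)
    then show "e \<in> (\<lambda>w. {v, w}) ` nbrs v" using e unfolding nbrs_def by auto
  qed
qed (auto simp: inc_def nbrs_def)

lemma deg_eq_card_nbrs: "deg v = card (nbrs v)"
  unfolding deg_def inc_eq by (rule card_image) (auto simp: inj_on_def doubleton_eq_iff)

lemma handshake: "(\<Sum>v\<in>V. deg v) = 2 * card E"
proof -
  have "(\<Sum>v\<in>V. deg v) = (\<Sum>v\<in>V. \<Sum>e\<in>E. if v \<in> e then 1 else 0)"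
    unfolding deg_def inc_def using finite_E by (simp add: sum.If_cases Int_def)
  also have "\<dots> = (\<Sum>e\<in>E. \<Sum>v\<in>V. if v \<in> e then 1 else 0)"
    by (rule sum.swap)
  also have "\<dots> = (\<Sum>e\<in>E. 2)"
  proof (rule sum.cong)
    fix e assume "e \<in> E"
    then have "V \<inter> {v. v \<in> e} = e" "card e = 2" using edge_subset edge_card by auto
    then show "(\<Sum>v\<in>V. if v \<in> e then 1 else 0) = (2::nat)"
      using finite_V by (simp add: sum.If_cases)
  qed simp
  finally show ?thesis by simp
qed

text \<open>Applied to the graph induced on the neighbours of a prospective centre \<open>c\<close>: colour red the spoke
  \<open>{c, x}\<close> and the listed matching. Then no vertex of \<open>S\<close> lies on a blue rim edge of a fan centred
  at \<open>c\<close>.\<close>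

definition isolable :: "'a set \<Rightarrow> bool" where
  "isolable S \<longleftrightarrow> (\<exists>x\<in>V - S. matching {e \<in> E. e \<inter> S \<noteq> {} \<and> x \<notin> e})"

lemma isolable_subset:
  assumes "isolable S" "T \<subseteq> S"
  shows "isolable T"
proof -
  obtain x where x: "x \<in> V - S" "matching {e \<in> E. e \<inter> S \<noteq> {} \<and> x \<notin> e}"
    using assms unfolding isolable_def by blast
  have "matching {e \<in> E. e \<inter> T \<noteq> {} \<and> x \<notin> e}"
    by (rule matching_subset[OF x(2)]) (use assms in auto)
  then show ?thesis using x assms unfolding isolable_def by blast
qed

lemma ex_other: "T \<subseteq> V \<Longrightarrow> card T < card V \<Longrightarrow> \<exists>x. x \<in> V - T"
  by (metis DiffI nat_less_le subsetI subset_antisym)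

section \<open>Isolating a few vertices of small degree\<close>

text \<open>If the edges at \<open>S\<close> do not form a matching, two of them meet in a vertex
  \<open>a\<close>, which is outside \<open>S\<close> because vertices of \<open>S\<close> have at
  most one edge. Taking \<open>x = a\<close> removes the edges of two vertices of \<open>S\<close>;
  at most one further vertex remains, hence the bound 3.\<close>

lemma isolable_low:
  assumes low: "\<And>y. y \<in> S \<Longrightarrow> deg y \<le> 1" and S: "S \<subseteq> V" "card S \<le> 3" "card S < card V"
  shows "isolable S"
proof (cases "matching {e \<in> E. e \<inter> S \<noteq> {}}")
  case True
  obtain x where x: "x \<in> V - S" using S ex_other by blast
  have "matching {e \<in> E. e \<inter> S \<noteq> {} \<and> x \<notin> e}"
    by (rule matching_subset[OF True]) auto
  then show ?thesis using x unfolding isolable_def by blast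
next
  case False
  have uniq: "e = f" if "y \<in> S" "e \<in> E" "f \<in> E" "y \<in> e" "y \<in> f" for y e f
    using low[OF that(1)] that card_le_Suc0_iff_eq[OF finite_inc[of y]]
    unfolding deg_def by (auto simp: inc_def)
  have finS: "finite S" using S finite_V finite_subset by blast
  obtain e f a where ef: "e \<in> E" "f \<in> E" "a \<in> e" "a \<in> f" "e \<noteq> f" "e \<inter> S \<noteq> {}" "f \<inter> S \<noteq> {}"
    using False unfolding matching_def by blast
  then have aS: "a \<notin> S" using uniq by blast
  obtain y z where y: "y \<in> S" "y \<in> e" and z: "z \<in> S" "z \<in> f" using ef by blast
  have "y \<noteq> z" using uniq y z ef by blast
  then have "card (S - {y, z}) \<le> 1" using y z S(2) finS by (simp add: card_Diff_subset)
  then have small: "\<forall>w\<in>S - {y, z}. \<forall>w'\<in>S - {y, z}. w = w'"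
    using card_le_Suc0_iff_eq finS by (metis One_nat_def finite_Diff)
  have "matching {g \<in> E. g \<inter> S \<noteq> {} \<and> a \<notin> g}"
  proof -
    have *: "\<exists>w\<in>S - {y, z}. w \<in> g" if "g \<in> E" "g \<inter> S \<noteq> {}" "a \<notin> g" for g
    proof -
      obtain w where w: "w \<in> g" "w \<in> S" using \<open>g \<inter> S \<noteq> {}\<close> by blast
      have "w \<noteq> y" using uniq[OF y(1) that(1) ef(1) _ y(2)] w that ef by auto
      moreover have "w \<noteq> z" using uniq[OF z(1) that(1) ef(2) _ z(2)] w that ef by auto
      ultimately show ?thesis using w by blast
    qed
    show ?thesis unfolding matching_def
    proof (intro ballI impI)
      fix g h assume gh: "g \<in> {g \<in> E. g \<inter> S \<noteq> {} \<and> a \<notin> g}" "h \<in> {g \<in> E. g \<inter> S \<noteq> {} \<and> a \<notin> g}"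
      obtain w where w: "w \<in> S - {y, z}" "w \<in> g" using * gh by blast
      obtain w' where w': "w' \<in> S - {y, z}" "w' \<in> h" using * gh by blast
      have "w = w'" using small w w' by blast
      then show "g = h" using uniq w w' gh by blast
    qed
  qed
  moreover have "a \<in> V - S" using aS ef edge_subset by blast
  ultimately show ?thesis unfolding isolable_def by blast
qed

text \<open>If \<open>z\<close> has two neighbours \<open>p\<close> and \<open>q\<close>, one of
  them is taken as \<open>x\<close>, so that \<open>z\<close> keeps a single edge. The choice
  ensures that this edge does not meet a different edge at \<open>y\<close>: the vertex
  \<open>x\<close> is the neighbour of \<open>z\<close> to which \<open>y\<close> is joined, if
  there is one, and differs from \<open>y\<close>.\<close>

lemma isolable_low_pair:
  assumes y: "y \<in> V" "deg y \<le> 1" and z: "z \<in> V" "deg z \<le> 2" and yz: "y \<noteq> z" and V: "card V > 2"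
  shows "isolable {y, z}"
proof (cases "deg z \<le> 1")
  case True
  then show ?thesis using isolable_low[of "{y, z}"] y z yz V by auto
next
  case False
  then have "deg z = 2" using z by simp
  then have "card (nbrs z) = 2" by (simp add: deg_eq_card_nbrs)
  then obtain p q where pq: "nbrs z = {p, q}" "p \<noteq> q" by (auto simp: card_2_iff)
  have incz: "e = {z, p} \<or> e = {z, q}" if "e \<in> E" "z \<in> e" for e
    using that pq inc_eq[of z] unfolding inc_def by auto
  have E: "{z, p} \<in> E" "{z, q} \<in> E" using pq unfolding nbrs_def by auto
  have ne: "p \<noteq> z" "q \<noteq> z" "p \<in> V" "q \<in> V"
    using pq not_in_nbrs[of z] nbrs_subset(1)[of z] by auto
  have uniq: "e = f" if "e \<in> E" "f \<in> E" "y \<in> e" "y \<in> f" for e f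
    using that y card_le_Suc0_iff_eq[OF finite_inc[of y]]
    unfolding deg_def by (auto simp: inc_def)
  have key: "isolable {y, z}" if r: "r \<in> {p, q}" "s \<in> {p, q}" "r \<noteq> s" "r \<noteq> y"
    and d: "\<And>f. f \<in> E \<Longrightarrow> y \<in> f \<Longrightarrow> s \<in> f \<Longrightarrow> r \<notin> f \<Longrightarrow> z \<in> f" for r s
  proof -
    have "matching {e \<in> E. e \<inter> {y, z} \<noteq> {} \<and> r \<notin> e}"
      unfolding matching_def
    proof (intro ballI impI)
      fix e f assume ef: "e \<in> {e \<in> E. e \<inter> {y, z} \<noteq> {} \<and> r \<notin> e}"
        "f \<in> {e \<in> E. e \<inter> {y, z} \<noteq> {} \<and> r \<notin> e}" "e \<inter> f \<noteq> {}"
      have zs: "g = {z, s}" if "g \<in> E" "z \<in> g" "r \<notin> g" for g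
        using incz[OF that(1,2)] that(3) r by auto
      consider "z \<in> e" "z \<in> f" | "y \<in> e" "y \<in> f" | "y \<in> e" "z \<in> f" "z \<notin> e" | "z \<in> e" "y \<in> f" "z \<notin> f"
        using ef by auto
      then show "e = f"
      proof cases
        case 1
        then show ?thesis using zs ef by auto
      next
        case 2
        then show ?thesis using uniq ef by auto
      next
        case 3
        then have "f = {z, s}" using zs ef by auto
        then have "s \<in> e" using 3 ef by auto
        then show ?thesis using d[of e] 3 ef by auto
      next
        case 4
        then have "e = {z, s}" using zs ef by auto
        then have "s \<in> f" using 4 ef by auto
        then show ?thesis using d[of f] 4 ef by auto
      qed
    qed
    moreover have "r \<in> V - {y, z}" using r ne by auto
    ultimately show ?thesis unfolding isolable_def by blast
  qed
  have pqf: "z \<in> f" if "f \<in> E" "y \<in> f" "y \<in> {p, q}" for f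
  proof -
    have "{z, y} \<in> E" using that E by auto
    then show ?thesis using uniq[OF that(1) _ that(2)] by auto
  qed
  show ?thesis
  proof (cases "p = y \<or> q = y")
    case True
    then show ?thesis using key[of q p] key[of p q] pqf pq by auto
  next
    case False
    show ?thesis
    proof (cases "\<exists>f\<in>E. y \<in> f \<and> p \<in> f")
      case True
      then obtain f where f: "f \<in> E" "y \<in> f" "p \<in> f" by blast
      have "q \<notin> f"
      proof -
        obtain w where "f = {y, w}" using edgeE f by metis
        then show ?thesis using f False pq by auto
      qed
      moreover have "g = f" if "g \<in> E" "y \<in> g" for g using uniq f that by blast
      ultimately show ?thesis using key[of p q] False pq by blast
    next
      case F: False
      then show ?thesis using key[of q p] False pq by blast
    qed
  qed
qed

text \<open>A neighbour of \<open>z\<close> as \<open>x\<close> removes one of at most two edges at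
  \<open>z\<close>, and a single edge is a matching.\<close>

lemma isolable_single:
  assumes "z \<in> V" "deg z \<le> 2" "card V > 1"
  shows "isolable {z}"
proof (cases "inc z = {}")
  case True
  then have "{e \<in> E. e \<inter> {z} \<noteq> {} \<and> x \<notin> e} = {}" for x unfolding inc_def by auto
  moreover obtain x where "x \<in> V - {z}" using ex_other[of "{z}"] assms by auto
  ultimately show ?thesis unfolding isolable_def matching_def by (metis empty_iff)
next
  case False
  then obtain e where e: "e \<in> E" "z \<in> e" unfolding inc_def by auto
  then obtain x where x: "e = {z, x}" "x \<noteq> z" "x \<in> V" by (meson edgeE)
  have sub: "{f \<in> E. f \<inter> {z} \<noteq> {} \<and> x \<notin> f} \<subseteq> inc z - {e}"
    unfolding inc_def x by auto
  have "card (inc z - {e}) \<le> 1" using e assms unfolding deg_def by (simp add: inc_def)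
  then have "matching {f \<in> E. f \<inter> {z} \<noteq> {} \<and> x \<notin> f}"
    using matching_subset[OF _ sub] matching_if_card_le_1[of "inc z - {e}"] finite_inc by auto
  then show ?thesis unfolding isolable_def using x by blast
qed

text \<open>\<open>S\<close> consists of the isolated vertices and one leaf at every vertex that is adjacent to a leaf.\<close>

lemma many_pendants:
  obtains S where "S \<subseteq> V" "card V \<le> card S + card E" "matching {e \<in> E. e \<inter> S \<noteq> {}}"
proof -
  define I where "I = {v \<in> V. deg v = 0}"
  define L where "L = {v \<in> V. deg v = 1}"
  define A where "A = {a \<in> V. \<exists>l\<in>L. {l, a} \<in> E}"
  have fin: "finite I" "finite L" "finite A" unfolding I_def L_def A_def using finite_V by auto
  have uniq: "e = f" if "l \<in> L" "e \<in> E" "f \<in> E" "l \<in> e" "l \<in> f" for l e f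
  proof -
    have "card (inc l) \<le> Suc 0" using that(1) unfolding L_def deg_def by simp
    then have "\<forall>e\<in>inc l. \<forall>f\<in>inc l. e = f"
      using card_le_Suc0_iff_eq[OF finite_inc] by blast
    then show ?thesis using that unfolding inc_def by blast
  qed
  have I0: "v \<notin> e" if "v \<in> I" "e \<in> E" for v e
    using that finite_inc[of v] unfolding I_def deg_def by (auto simp: inc_def)
  have "\<forall>a\<in>A. \<exists>x. x \<in> L \<and> {x, a} \<in> E" unfolding A_def by blast
  from bchoice[OF this] obtain l where l: "\<And>a. a \<in> A \<Longrightarrow> l a \<in> L \<and> {l a, a} \<in> E" by blast
  have inj: "inj_on l A"
  proof (rule inj_onI)
    fix a b assume ab: "a \<in> A" "b \<in> A" "l a = l b"
    have "{l a, a} = {l b, b}" using uniq[of "l a"] l[OF ab(1)] l[OF ab(2)] ab(3) by simp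
    then show "a = b" using ab(3) by (auto simp: doubleton_eq_iff)
  qed
  define S where "S = I \<union> l ` A"
  have LV: "L \<subseteq> V" "I \<subseteq> V" "A \<subseteq> V" unfolding L_def I_def A_def by auto
  have "S \<subseteq> V" using LV l unfolding S_def by blast
  have "I \<inter> L = {}" unfolding I_def L_def by auto
  then have "I \<inter> l ` A = {}" using l by blast
  then have cS: "card S = card I + card A"
    unfolding S_def using fin inj by (simp add: card_Un_disjoint card_image)
  have form: "\<exists>a\<in>A. e = {l a, a}" if e: "e \<in> E" "e \<inter> S \<noteq> {}" for e
  proof -
    obtain s where s: "s \<in> e" "s \<in> S" using e by blast
    then obtain a where a: "a \<in> A" "s = l a" using I0 e unfolding S_def by blast
    have "e = {l a, a}" using uniq[of "l a" e "{l a, a}"] l[OF a(1)] s a e by simp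
    then show ?thesis using a by blast
  qed
  have "matching {e \<in> E. e \<inter> S \<noteq> {}}"
    unfolding matching_def
  proof (intro ballI impI)
    fix e f assume ef: "e \<in> {e \<in> E. e \<inter> S \<noteq> {}}" "f \<in> {e \<in> E. e \<inter> S \<noteq> {}}" "e \<inter> f \<noteq> {}"
    obtain a where a: "a \<in> A" "e = {l a, a}" using form ef by blast
    obtain b where b: "b \<in> A" "f = {l b, b}" using form ef by blast
    consider "l a \<in> f" | "l b \<in> e" | "a = b" using ef(3) a b by auto
    then show "e = f"
    proof cases
      case 1
      then show ?thesis using uniq[of "l a" e f] l[OF a(1)] a ef by auto
    next
      case 2
      then show ?thesis using uniq[of "l b" e f] l[OF b(1)] b ef by auto
    next
      case 3
      then show ?thesis using a b by simp
    qed
  qed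
  \<comment> \<open>By the choice of \<open>S\<close> it suffices that \<open>B\<close>, the
    vertices outside \<open>A\<close> and \<open>I\<close>, has at most \<open>card E\<close>
    elements. The degrees in \<open>A\<close> sum to at least \<open>card L\<close>, as every leaf
    has its neighbour in \<open>A\<close>; those in \<open>B\<close> sum to at least
    \<open>2 * card B - card L\<close>. The handshake identity gives the claim.\<close>
  moreover have "card V \<le> card S + card E"
  proof -
    have "L \<subseteq> (\<Union>a\<in>A. nbrs a)"
    proof
      fix v assume v: "v \<in> L"
      then obtain e where "e \<in> inc v" unfolding L_def deg_def by fastforce
      then have e: "e \<in> E" "v \<in> e" unfolding inc_def by auto
      then obtain w where w: "e = {v, w}" "w \<in> V" by (meson edgeE)
      then have "w \<in> A" using v e unfolding A_def by auto
      moreover have "v \<in> nbrs w" using w e unfolding nbrs_def by (simp add: insert_commute)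
      ultimately show "v \<in> (\<Union>a\<in>A. nbrs a)" by blast
    qed
    then have "card L \<le> card (\<Union>a\<in>A. nbrs a)"
      using fin nbrs_subset by (intro card_mono) auto
    also have "\<dots> \<le> (\<Sum>a\<in>A. deg a)"
      unfolding deg_eq_card_nbrs using fin by (intro card_UN_le)
    finally have 1: "card L \<le> (\<Sum>a\<in>A. deg a)" .
    define B where "B = V - A - I"
    have "(\<Sum>v\<in>B. if v \<in> L then 1 else 2) \<le> (\<Sum>v\<in>B. deg v)"
      unfolding B_def I_def L_def by (intro sum_mono) auto
    moreover have "(\<Sum>v\<in>B. if v \<in> L then 1 else 2) + card (B \<inter> L) = 2 * card B"
    proof -
      have "finite B" unfolding B_def using finite_V by simp
      then have "card B = card (B \<inter> L) + card (B \<inter> - L)"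
        by (metis Diff_eq card_Diff_subset_Int card_mono finite_Int inf_le1 le_add_diff_inverse)
      then show ?thesis using \<open>finite B\<close> by (simp add: sum.If_cases)
    qed
    moreover have "card (B \<inter> L) \<le> card L" using fin by (simp add: card_mono)
    moreover have "A \<inter> I = {}" using I0 l by blast
    then have "V = A \<union> I \<union> B" "A \<inter> B = {}" "I \<inter> B = {}"
      using LV unfolding B_def by auto
    moreover have "finite B" unfolding B_def using finite_V by simp
    moreover have "(\<Sum>v\<in>A \<union> I \<union> B. deg v) = (\<Sum>v\<in>A. deg v) + (\<Sum>v\<in>I. deg v) + (\<Sum>v\<in>B. deg v)"
      using fin \<open>finite B\<close> \<open>A \<inter> I = {}\<close> \<open>A \<inter> B = {}\<close> \<open>I \<inter> B = {}\<close>
      by (subst sum.union_disjoint; (subst sum.union_disjoint)?) auto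
    moreover have "card (A \<union> I \<union> B) = card A + card I + card B"
      using fin \<open>finite B\<close> \<open>A \<inter> I = {}\<close> \<open>A \<inter> B = {}\<close> \<open>I \<inter> B = {}\<close>
      by (subst card_Un_disjoint; (subst card_Un_disjoint)?) auto
    ultimately show ?thesis using 1 handshake cS by simp
  qed
  ultimately show ?thesis using that \<open>S \<subseteq> V\<close> by blast
qed

text \<open>If two vertices with a common neighbour \<open>x\<close> never can be isolated by deleting \<open>x\<close> and a matching,
  then every component of degree two is a 4-cycle.\<close>

lemma two_regular_isolable:
  assumes reg: "\<And>v. v \<in> V \<Longrightarrow> deg v = 0 \<or> deg v = 2"
    and odd: "\<not> 4 dvd card {v \<in> V. deg v = 2}"
  shows "\<exists>u w. u \<noteq> w \<and> deg u = 2 \<and> deg w = 2 \<and> u \<in> V \<and> w \<in> V \<and>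
    isolable ({u, w} \<union> {v \<in> V. deg v = 0})"
proof (rule ccontr)
  assume "\<not> ?thesis"
  then have no: "\<not> isolable ({u, w} \<union> {v \<in> V. deg v = 0})"
    if "u \<noteq> w" "deg u = 2" "deg w = 2" "u \<in> V" "w \<in> V" for u w
    using that by blast
  define U where "U = {v \<in> V. deg v = 2}"
  have deg2: "y \<in> U" if "y \<in> nbrs x" for x y
  proof -
    have "y \<in> V" using that nbrs_subset by blast
    moreover have "nbrs y \<noteq> {}" using that nbrs_sym by blast
    then have "deg y \<noteq> 0" using nbrs_subset(2)[of y] unfolding deg_eq_card_nbrs by simp
    ultimately show ?thesis using reg[of y] unfolding U_def by simp
  qed
  have two: "\<exists>u w. nbrs x = {u, w} \<and> u \<noteq> w" if "x \<in> U" for x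
    using that unfolding U_def deg_eq_card_nbrs by (auto simp: card_2_iff)
  have other: "\<exists>v. nbrs x = {u, v} \<and> u \<noteq> v" if "u \<in> nbrs x" for u x
  proof -
    have "x \<in> U" using that deg2 nbrs_sym by blast
    then show ?thesis using two that by fastforce
  qed
  \<comment> \<open>Otherwise deleting \<open>x\<close> leaves \<open>u\<close> and \<open>w\<close>
    one edge each, to different vertices \<open>u'\<close> and \<open>w'\<close>, and these edges
    form a matching. Vertices of degree 0 have no edges and are isolated anyway.\<close>
  have twins: "nbrs u = nbrs w" if ux: "u \<in> nbrs x" "w \<in> nbrs x" for u w x
  proof (rule ccontr)
    assume ne: "nbrs u \<noteq> nbrs w"
    then have uw: "u \<noteq> w" by blast
    obtain u' where u': "nbrs u = {x, u'}" "x \<noteq> u'" using other[OF nbrs_sym[THEN iffD1, OF ux(1)]] by blast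
    obtain w' where w': "nbrs w = {x, w'}" "x \<noteq> w'" using other[OF nbrs_sym[THEN iffD1, OF ux(2)]] by blast
    have "u' \<noteq> w'" using ne u' w' by auto
    have U: "u \<in> U" "w \<in> U" "x \<in> U" using ux deg2 nbrs_sym[THEN iffD1, OF ux(1)] by blast+
    have eu: "e = {u, u'}" if "e \<in> E" "u \<in> e" "x \<notin> e" for e
      using that inc_eq[of u] u' unfolding inc_def by auto
    have ew: "e = {w, w'}" if "e \<in> E" "w \<in> e" "x \<notin> e" for e
      using that inc_eq[of w] w' unfolding inc_def by auto
    have cross: "e = {u, u'} \<or> e = {w, w'}"
      if "e \<in> {e \<in> E. e \<inter> ({u, w} \<union> {v \<in> V. deg v = 0}) \<noteq> {} \<and> x \<notin> e}" for e
    proof -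
      have "v \<notin> e" if "deg v = 0" for v
        using that \<open>e \<in> _\<close> finite_inc[of v] unfolding deg_def by (auto simp: inc_def)
      then show ?thesis using eu ew that by blast
    qed
    \<comment> \<open>The two edges can only meet if \<open>u\<close> and \<open>w\<close> are
      adjacent, and then both are the edge \<open>{u, w}\<close>.\<close>
    have meet: "{u, u'} = {w, w'}" if "{u, u'} \<inter> {w, w'} \<noteq> {}" "{u, u'} \<in> E" "{w, w'} \<in> E"
    proof -
      from that(1) consider "u = w'" | "u' = w" using uw \<open>u' \<noteq> w'\<close> by auto
      then show ?thesis
      proof cases
        case 1
        then have "w \<in> nbrs u" using that unfolding nbrs_def by (simp add: insert_commute)
        moreover have "w \<noteq> x" using \<open>w \<in> nbrs x\<close> not_in_nbrs by blast
        ultimately show ?thesis using u' 1 by auto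
      next
        case 2
        then have "u \<in> nbrs w" using that unfolding nbrs_def by (simp add: insert_commute)
        moreover have "u \<noteq> x" using \<open>u \<in> nbrs x\<close> not_in_nbrs by blast
        ultimately show ?thesis using w' 2 by auto
      qed
    qed
    have "matching {e \<in> E. e \<inter> ({u, w} \<union> {v \<in> V. deg v = 0}) \<noteq> {} \<and> x \<notin> e}"
      unfolding matching_def
    proof (intro ballI impI)
      fix e f assume ef: "e \<in> {e \<in> E. e \<inter> ({u, w} \<union> {v \<in> V. deg v = 0}) \<noteq> {} \<and> x \<notin> e}"
        "f \<in> {e \<in> E. e \<inter> ({u, w} \<union> {v \<in> V. deg v = 0}) \<noteq> {} \<and> x \<notin> e}" "e \<inter> f \<noteq> {}"
      then have E: "e \<in> E" "f \<in> E" by auto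
      show "e = f"
        using cross[OF ef(1)] cross[OF ef(2)] meet E ef(3) by (metis inf_commute)
    qed
    moreover have "x \<in> V - ({u, w} \<union> {v \<in> V. deg v = 0})"
      using U ux not_in_nbrs unfolding U_def by auto
    ultimately have "isolable ({u, w} \<union> {v \<in> V. deg v = 0})" unfolding isolable_def by blast
    then show False using no[OF uw] U unfolding U_def by blast
  qed
  \<comment> \<open>This is the component of \<open>x\<close>: by \<open>twins\<close> it is a
    4-cycle consisting of \<open>x\<close>, its two neighbours and their second common
    neighbour.\<close>
  define C where "C x = nbrs x \<union> \<Union>(nbrs ` nbrs x)" for x
  have C: "card (C x) = 4 \<and> x \<in> C x \<and> C x \<subseteq> U \<and> (\<forall>y\<in>C x. C y = C x)" if x: "x \<in> U" for x
  proof -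
    obtain u w where uw: "nbrs x = {u, w}" "u \<noteq> w" using two x by blast
    then have "x \<in> nbrs u" using nbrs_sym[of u x] by simp
    then obtain z where z: "nbrs u = {x, z}" "x \<noteq> z" using other by blast
    have w: "nbrs w = {x, z}" using twins[of u x w] uw z by auto
    have nz: "nbrs z = {u, w}" using twins[of x u z] uw z by auto
    have "x \<noteq> u" "x \<noteq> w" "z \<noteq> u" "z \<noteq> w"
      using not_in_nbrs[of x] not_in_nbrs[of z] uw nz by auto
    moreover have Cs: "C x = {u, w, x, z}" "C u = {u, w, x, z}" "C w = {u, w, x, z}" "C z = {u, w, x, z}"
      unfolding C_def using uw z w nz by auto
    moreover have "C x \<subseteq> U" unfolding C_def using deg2 by blast
    ultimately show ?thesis using uw z by auto
  qed
  \<comment> \<open>The components partition \<open>U\<close> into blocks of four, against the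
    assumption on divisibility.\<close>
  have "4 * card (C ` U) = card (\<Union>(C ` U))"
  proof (rule card_partition)
    have "finite U" unfolding U_def using finite_V by simp
    then show "finite (C ` U)" by simp
    show "finite (\<Union>(C ` U))" using C \<open>finite U\<close> by (meson finite_subset UN_least)
    show "card c = 4" if "c \<in> C ` U" for c using that C by blast
    show "c \<inter> d = {}" if cd: "c \<in> C ` U" "d \<in> C ` U" "c \<noteq> d" for c d
    proof (rule ccontr)
      assume "c \<inter> d \<noteq> {}"
      then obtain y where y: "y \<in> c" "y \<in> d" by blast
      obtain a where a: "a \<in> U" "c = C a" using cd by blast
      obtain b where b: "b \<in> U" "d = C b" using cd by blast
      have "C y = c" using C[OF a(1)] a y by blast
      moreover have "C y = d" using C[OF b(1)] b y by blast
      ultimately show False using cd by simp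
    qed
  qed
  moreover have "\<Union>(C ` U) = U" using C by blast
  ultimately show False using odd unfolding U_def by (metis dvd_triv_left)
qed

section \<open>Lower bounds\<close>

text \<open>Put k = \<open>card V - 2 * n\<close>; at least k vertices have to be isolated. The
  larger k is, the fewer edges the bound on \<open>card V + card E\<close> allows: k = 1 needs one
  vertex of degree at most 2, k = 2 and k = 3 end in critical graphs whose degrees are all 0 or 2,
  and from k = 4 on \<open>many_pendants\<close> suffices.\<close>

lemma ex_isolable:
  assumes n: "n \<ge> 2" and V: "card V \<ge> 2 * n + 1" and total: "card V + card E \<le> 4 * n + 4"
    and total_odd: "odd n \<Longrightarrow> card V + card E \<le> 4 * n + 3"
  shows "\<exists>S\<subseteq>V. isolable S \<and> card V \<le> card S + 2 * n"
proof -
  have bound: "k * card T \<le> 2 * card E" if "T \<subseteq> V" "\<And>v. v \<in> T \<Longrightarrow> k \<le> deg v" for k T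
  proof -
    have "card T * k \<le> (\<Sum>v\<in>T. deg v)" using sum_bounded_below[of T k deg] that(2) by simp
    also have "\<dots> \<le> (\<Sum>v\<in>V. deg v)" using that(1) finite_V by (intro sum_mono2) auto
    finally show ?thesis using handshake by (simp add: mult.commute)
  qed
  \<comment> \<open>A matching alone isolates \<open>card V - card E\<close> vertices;
    \<open>k < card V\<close> leaves a vertex to serve as \<open>x\<close>.\<close>
  have pendant: ?thesis if s: "card V \<le> k + 2 * n" "card E + k \<le> card V" "k < card V" for k
  proof -
    obtain S where S: "S \<subseteq> V" "card V \<le> card S + card E" "matching {e \<in> E. e \<inter> S \<noteq> {}}"
      by (rule many_pendants)
    then have "k \<le> card S" using s by simp
    then obtain T where T: "T \<subseteq> S" "card T = k" by (meson obtain_subset_with_card_n)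
    obtain x where x: "x \<in> V - T" using ex_other[of T] T S s by auto
    have "matching {e \<in> E. e \<inter> T \<noteq> {} \<and> x \<notin> e}"
      by (rule matching_subset[OF S(3)]) (use T in auto)
    then have "isolable T" using x unfolding isolable_def by blast
    then show ?thesis using T S s by blast
  qed
  consider "card V = 2 * n + 1" | "card V = 2 * n + 2" | "card V = 2 * n + 3" | "card V \<ge> 2 * n + 4"
    using V by linarith
  then show ?thesis
  proof cases
    case 1
    have "\<exists>z\<in>V. deg z \<le> 2"
    proof (rule ccontr)
      assume "\<not> ?thesis"
      then have "3 * card V \<le> 2 * card E" using bound[of V 3] by force
      then show False using 1 total n by simp
    qed
    then obtain z where z: "z \<in> V" "deg z \<le> 2" by blast
    then have "isolable {z}" using isolable_single 1 n by simp
    then show ?thesis using z 1 by (intro exI[of _ "{z}"]) simp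
  next
    case 2
    show ?thesis
    proof (cases "\<exists>y\<in>V. deg y \<le> 1")
      case True
      then obtain y where y: "y \<in> V" "deg y \<le> 1" by blast
      have "\<exists>z\<in>V - {y}. deg z \<le> 2"
      proof (rule ccontr)
        assume "\<not> ?thesis"
        then have "3 * card (V - {y}) \<le> 2 * card E" using bound[of "V - {y}" 3] by force
        then show False using 2 total n y finite_V by simp
      qed
      then obtain z where z: "z \<in> V" "z \<noteq> y" "deg z \<le> 2" by blast
      then have "isolable {y, z}" using isolable_low_pair[of y z] y 2 n by simp
      then show ?thesis using y z 2 by (intro exI[of _ "{y, z}"]) simp
    next
      case False
      then have low: "2 \<le> deg v" if "v \<in> V" for v using that by force
      then have "2 * card V \<le> 2 * card E" using bound[of V 2] by simp
      \<comment> \<open>Minimum degree 2 forces at least 2n + 2 edges, so the total bound is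
        attained, which excludes odd \<open>n\<close>. The graph is then 2-regular, and for even
        \<open>n\<close> its order 2n + 2 is not a multiple of 4.\<close>
      then have e: "card E = card V" "even n" using 2 total total_odd by auto
      have deg2: "deg v = 2" if v: "v \<in> V" for v
      proof (rule ccontr)
        assume "deg v \<noteq> 2"
        then have "2 < deg v" using low v by force
        then have "(\<Sum>v\<in>V. 2) < (\<Sum>v\<in>V. deg v)"
          using low v finite_V by (intro sum_strict_mono_ex1) auto
        then show False using handshake e by simp
      qed
      then have "{v \<in> V. deg v = 2} = V" by auto
      moreover have "\<not> 4 dvd card V" using 2 e(2) by presburger
      ultimately obtain u w where "u \<noteq> w" "u \<in> V" "w \<in> V"
        "isolable ({u, w} \<union> {v \<in> V. deg v = 0})"
        using two_regular_isolable deg2 by metis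
      then have "u \<noteq> w" "u \<in> V" "w \<in> V" "isolable {u, w}" using isolable_subset by blast+
      then show ?thesis using 2 by (intro exI[of _ "{u, w}"]) simp
    qed
  next
    case 3
    show ?thesis
    proof (cases "card E + 3 \<le> card V")
      case True
      then show ?thesis using pendant[of 3] 3 n by simp
    next
      case False
      then have e: "card E = 2 * n + 1" "even n" using 3 total total_odd by auto
      define L where "L = {v \<in> V. deg v \<le> 1}"
      have L: "L \<subseteq> V" "finite L" unfolding L_def using finite_V by auto
      show ?thesis
      proof (cases "3 \<le> card L")
        case True
        then obtain S where S: "S \<subseteq> L" "card S = 3" by (meson obtain_subset_with_card_n)
        then have "isolable S" using isolable_low[of S] L 3 n unfolding L_def by auto
        then show ?thesis using S L 3 by (intro exI[of _ S]) auto
      next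
        case False
        \<comment> \<open>With 2n + 1 edges on 2n + 3 vertices, counting degrees forces exactly two
          vertices of degree below 2, both isolated, while the other 2n + 1 have degree 2. This odd
          number is not a multiple of 4.\<close>
        have high: "2 \<le> deg v" if "v \<in> V - L" for v using that unfolding L_def by auto
        have cVL: "card (V - L) = card V - card L" using L finite_V by (simp add: card_Diff_subset)
        have "2 * card (V - L) \<le> 2 * card E" using bound[of "V - L" 2] high by blast
        then have c2: "card L = 2" using cVL e 3 False by simp
        have split: "(\<Sum>v\<in>V. deg v) = (\<Sum>v\<in>V - L. deg v) + (\<Sum>v\<in>L. deg v)"
          using L finite_V by (simp add: sum.subset_diff)
        have ge: "(\<Sum>v\<in>V - L. 2) \<le> (\<Sum>v\<in>V - L. deg v)" using high by (intro sum_mono) blast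
        have s2: "(\<Sum>v\<in>V - L. 2) = 2 * card E" using cVL e 3 c2 by simp
        have "(\<Sum>v\<in>L. deg v) = 0" using split ge s2 handshake by simp
        then have L0: "deg v = 0" if "v \<in> L" for v using that L by simp
        have deg2: "deg v = 2" if v: "v \<in> V - L" for v
        proof (rule ccontr)
          assume "deg v \<noteq> 2"
          then have "2 < deg v" using high v by force
          then have "(\<Sum>v\<in>V - L. 2) < (\<Sum>v\<in>V - L. deg v)"
            using high v finite_V by (intro sum_strict_mono_ex1) auto
          then show False using handshake split s2 by simp
        qed
        have "{v \<in> V. deg v = 2} = V - L" using deg2 L0 by force
        moreover have "{v \<in> V. deg v = 0} = L" using deg2 L0 L by force
        moreover have "\<not> 4 dvd card (V - L)" using cVL 3 c2 by presburger
        ultimately obtain u w where uw: "u \<noteq> w" "u \<in> V" "w \<in> V" "deg u = 2" "isolable ({u, w} \<union> L)"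
          using two_regular_isolable deg2 L0 by (metis DiffI)
        then have "isolable (insert u L)" using isolable_subset by blast
        moreover have "u \<notin> L" using uw L0 by force
        ultimately show ?thesis using uw L c2 3 by (intro exI[of _ "insert u L"]) auto
      qed
    qed
  next
    case 4
    \<comment> \<open>The total bound gives \<open>card E + (card V - 2 * n)\<close> at most 2n + 4,
      hence at most \<open>card V\<close>.\<close>
    then show ?thesis using pendant[of "card V - 2 * n"] total n by simp
  qed
qed

text \<open>The 2n rim vertices are joined to \<open>c\<close> by blue edges, and a red edge at
  \<open>c\<close> comes on top of these. So the last clause rules out as a centre every vertex of
  degree exactly 2n with a red edge.\<close>

lemma fan_centreE:
  assumes "has_fan n (E - M)" "n > 0"
  obtains c K where "K \<subseteq> E - M" "card K = n" "matching K" "\<forall>w\<in>\<Union>K. {c, w} \<in> E - M"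
    "c \<notin> \<Union>K" "card (\<Union>K) = 2 * n" "\<Union>K \<subseteq> nbrs c" "2 * n \<le> deg c" "c \<in> V"
    "\<And>x. {c, x} \<in> E \<Longrightarrow> {c, x} \<in> M \<Longrightarrow> 2 * n < deg c"
proof -
  obtain c K where K: "K \<subseteq> E - M" "card K = n" "matching K" "c \<notin> \<Union>K" "\<forall>w\<in>\<Union>K. {c, w} \<in> E - M"
    using assms unfolding has_fan_def by blast
  have "finite K" using K finite_E finite_subset by blast
  then have c: "card (\<Union>K) = 2 * n"
    using card_Union_matching[OF K(3)] K(1,2) edge_card by blast
  have sub: "\<Union>K \<subseteq> nbrs c" using K(5) unfolding nbrs_def by blast
  then have d: "2 * n \<le> deg c"
    using card_mono[OF nbrs_subset(2) sub] c unfolding deg_eq_card_nbrs by simp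
  have "\<Union>K \<noteq> {}" using c assms by force
  then have cV: "c \<in> V" using K(5) edge_subset by blast
  have "2 * n < deg c" if x: "{c, x} \<in> E" "{c, x} \<in> M" for x
  proof -
    have "x \<notin> \<Union>K" using K(5) x by blast
    moreover have "x \<in> nbrs c" using x unfolding nbrs_def by simp
    ultimately have "\<Union>K \<subset> nbrs c" using sub by blast
    then show ?thesis
      using psubset_card_mono[OF nbrs_subset(2)] c unfolding deg_eq_card_nbrs by metis
  qed
  then show ?thesis using that K c sub d cV by blast
qed

lemma card_inc_Int: "u \<noteq> v \<Longrightarrow> card (inc u \<inter> inc v) \<le> (if {u, v} \<in> E then 1 else 0)"
proof -
  assume uv: "u \<noteq> v"
  have *: "e = {u, v}" if "e \<in> inc u \<inter> inc v" for e
  proof -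
    have e: "e \<in> E" "u \<in> e" "v \<in> e" using that unfolding inc_def by auto
    then obtain w where "e = {u, w}" by (meson edgeE)
    then show ?thesis using e uv by auto
  qed
  show ?thesis
  proof (cases "{u, v} \<in> E")
    case True
    have "card (inc u \<inter> inc v) \<le> card {{u, v}}" using * by (intro card_mono) auto
    then show ?thesis using True by simp
  next
    case False
    then have "inc u \<inter> inc v = {}" using * unfolding inc_def by blast
    then show ?thesis by simp
  qed
qed

section \<open>Host graphs with three, two or one prospective centre\<close>

text \<open>The three stars have pairwise at most one common edge, so together at least 6n - 3
  edges. Equality must hold: the degrees are 2n, \<open>u\<close> and \<open>v\<close> are adjacent,
  and every edge meets \<open>u\<close>, \<open>v\<close> or \<open>w\<close>. Two disjoint red
  edges then touch all three, and any other vertex has degree at most 3 < 2n.\<close>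

lemma three_centres:
  assumes n: "n \<ge> 2" and E: "card E + 3 \<le> 6 * n"
    and uvw: "u \<noteq> v" "u \<noteq> w" "v \<noteq> w" "2 * n \<le> deg u" "2 * n \<le> deg v" "2 * n \<le> deg w"
  shows "\<exists>M\<subseteq>E. matching M \<and> \<not> has_fan n (E - M)"
proof -
  let ?A = "inc u" and ?B = "inc v" and ?C = "inc w"
  have fin: "finite ?A" "finite ?B" "finite ?C" using finite_inc by auto
  have "card ?A + card ?B = card (?A \<union> ?B) + card (?A \<inter> ?B)"
    using card_Un_Int[of ?A ?B] fin by simp
  moreover have "card (?A \<union> ?B) + card ?C = card (?A \<union> ?B \<union> ?C) + card ((?A \<union> ?B) \<inter> ?C)"
    using card_Un_Int[of "?A \<union> ?B" ?C] fin by simp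
  moreover have "card ((?A \<union> ?B) \<inter> ?C) \<le> card (?A \<inter> ?C) + card (?B \<inter> ?C)"
    unfolding Int_Un_distrib2 by (rule card_Un_le)
  moreover have "card (?A \<inter> ?B) \<le> (if {u, v} \<in> E then 1 else 0)" using card_inc_Int uvw by blast
  moreover have i: "card (inc x \<inter> inc y) \<le> 1" if "x \<noteq> y" for x y
    using card_inc_Int[OF that] by (simp split: if_splits)
  have "card (?A \<inter> ?C) \<le> 1" "card (?B \<inter> ?C) \<le> 1" using i uvw by blast+
  moreover have sub: "?A \<union> ?B \<union> ?C \<subseteq> E" unfolding inc_def by blast
  then have "card (?A \<union> ?B \<union> ?C) \<le> card E" using finite_E card_mono by blast
  ultimately have uv: "{u, v} \<in> E" and d: "deg u = 2 * n" "deg v = 2 * n" "deg w = 2 * n"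
    and "card (?A \<union> ?B \<union> ?C) = card E"
    using uvw(4-6) E unfolding deg_def by (auto split: if_splits)
  then have all: "?A \<union> ?B \<union> ?C = E" using sub finite_E card_subset_eq by blast
  have "card {u, v} < card (nbrs w)" using d n uvw unfolding deg_eq_card_nbrs by simp
  then have "\<not> nbrs w \<subseteq> {u, v}" using card_mono[of "{u, v}" "nbrs w"] by auto
  then obtain a where a: "{w, a} \<in> E" "a \<noteq> u" "a \<noteq> v" unfolding nbrs_def by blast
  define M where "M = {{u, v}, {w, a}}"
  have "matching M" unfolding M_def matching_def using a uvw by auto
  moreover have "M \<subseteq> E" using uv a unfolding M_def by auto
  moreover have "\<not> has_fan n (E - M)"
  proof
    assume "has_fan n (E - M)"
    then obtain c where c: "2 * n \<le> deg c" "\<And>x. {c, x} \<in> E \<Longrightarrow> {c, x} \<in> M \<Longrightarrow> 2 * n < deg c"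
      using n by (elim fan_centreE) auto
    show False
    proof (cases "c \<in> {u, v, w}")
      case True
      then show False
        using c(2)[of u] c(2)[of v] c(2)[of a] uv a d unfolding M_def by (auto simp: insert_commute)
    next
      case False
      have "inc c = (inc c \<inter> ?A) \<union> (inc c \<inter> ?B) \<union> (inc c \<inter> ?C)"
        using all unfolding inc_def by blast
      then have "card (inc c) \<le> card (inc c \<inter> ?A) + card (inc c \<inter> ?B) + card (inc c \<inter> ?C)"
        by (metis (no_types, lifting) add_le_mono1 card_Un_le order_trans)
      then show False
        using i[of c u] i[of c v] i[of c w] False c(1) n unfolding deg_def by simp
    qed
  qed
  ultimately show ?thesis by blast
qed

text \<open>Colour red a maximum matching of the edges avoiding both centres, together with the edge \<open>{u, v}\<close>
  if it is present: the rim of a blue fan is disjoint from that matching and no larger.\<close>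

lemma two_centres:
  assumes n: "n \<ge> 2" and E: "card E + 1 < 6 * n"
    and uv: "u \<noteq> v" "2 * n \<le> deg u" "2 * n \<le> deg v"
    and only: "\<And>c. 2 * n \<le> deg c \<Longrightarrow> c = u \<or> c = v"
  shows "\<exists>M\<subseteq>E. matching M \<and> \<not> has_fan n (E - M)"
proof -
  define R where "R = {e \<in> E. u \<notin> e \<and> v \<notin> e}"
  have finR: "finite R" unfolding R_def using finite_E by simp
  have "\<exists>x. (x \<subseteq> R \<and> matching x) \<and> (\<forall>y. y \<subseteq> R \<and> matching y \<longrightarrow> card y \<le> card x)"
  proof (rule ex_has_greatest_nat)
    show "{} \<subseteq> R \<and> matching {}" unfolding matching_def by simp
    show "\<forall>y. y \<subseteq> R \<and> matching y \<longrightarrow> card y < Suc (card R)"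
      using finR card_mono by (auto simp: less_Suc_eq_le)
  qed
  then obtain X where X: "X \<subseteq> R" "matching X" "\<And>Y. Y \<subseteq> R \<Longrightarrow> matching Y \<Longrightarrow> card Y \<le> card X"
    by blast
  define M where "M = X \<union> ({{u, v}} \<inter> E)"
  have "matching M" unfolding M_def
    by (rule matching_Un[OF X(2)]) (use X(1) in \<open>auto simp: R_def matching_def\<close>)
  moreover have "M \<subseteq> E" unfolding M_def using X(1) unfolding R_def by blast
  moreover have "\<not> has_fan n (E - M)"
  proof
    assume "has_fan n (E - M)"
    then obtain c K where K: "K \<subseteq> E - M" "card K = n" "matching K" "\<forall>w\<in>\<Union>K. {c, w} \<in> E - M"
      "c \<notin> \<Union>K" "2 * n \<le> deg c"
      using n by (elim fan_centreE) auto
    have c: "c = u \<or> c = v" using only K by blast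
    have "{u, v} \<notin> E - M" "{v, u} \<notin> E - M" unfolding M_def by (auto simp: insert_commute)
    then have "u \<notin> \<Union>K" "v \<notin> \<Union>K" using c K(4,5) by blast+
    then have KR: "K \<subseteq> R" using K(1) unfolding R_def by blast
    then have "n \<le> card X" using X(3) K by blast
    moreover have "K \<inter> X = {}" using K(1) unfolding M_def by blast
    then have "card (K \<union> X) = card K + card X"
      using KR X finR finite_subset by (metis card_Un_disjoint)
    moreover have "card (K \<union> X) \<le> card R" using KR X finR by (simp add: card_mono)
    \<comment> \<open>These edges avoid both centres; the two stars add at least 4n - 1,
      contradicting \<open>card E + 1 < 6 * n\<close>.\<close>
    ultimately have "2 * n \<le> card R" using K by simp
    moreover have "card (inc u) + card (inc v) \<le> card (inc u \<union> inc v) + 1"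
      using card_Un_Int[OF finite_inc finite_inc, of u v] card_inc_Int[OF uv(1)] by (simp split: if_splits)
    moreover have "card E = card R + card (inc u \<union> inc v)"
    proof -
      have "E = R \<union> (inc u \<union> inc v)" "R \<inter> (inc u \<union> inc v) = {}"
        unfolding R_def inc_def by auto
      then show ?thesis using finR finite_inc by (metis card_Un_disjoint finite_Un)
    qed
    ultimately show False using uv(2,3) E unfolding deg_def by simp
  qed
  ultimately show ?thesis by blast
qed

text \<open>If \<open>deg v = 2 * n\<close>, one red spoke suffices. Otherwise the spokes at
  \<open>v\<close> and the edges among its neighbours are disjoint parts of \<open>E\<close>, so the
  bound on \<open>card E\<close> is what \<open>ex_isolable\<close> requires. A rim at
  \<open>v\<close> has to avoid \<open>S\<close> and \<open>x\<close>, which leaves fewer than 2n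
  vertices.\<close>

lemma one_centre:
  assumes n: "n \<ge> 2" and E: "card E \<le> 4 * n + 4" "odd n \<Longrightarrow> card E \<le> 4 * n + 3"
    and v: "2 * n \<le> deg v" and only: "\<And>c. 2 * n \<le> deg c \<Longrightarrow> c = v"
  shows "\<exists>M\<subseteq>E. matching M \<and> \<not> has_fan n (E - M)"
proof (cases "deg v = 2 * n")
  case True
  then have "nbrs v \<noteq> {}" using n unfolding deg_eq_card_nbrs by force
  then obtain x where x: "{v, x} \<in> E" unfolding nbrs_def by blast
  have "\<not> has_fan n (E - {{v, x}})"
  proof
    assume "has_fan n (E - {{v, x}})"
    then obtain c where c: "2 * n \<le> deg c"
      "\<And>y. {c, y} \<in> E \<Longrightarrow> {c, y} \<in> {{v, x}} \<Longrightarrow> 2 * n < deg c"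
      using n by (elim fan_centreE) auto
    then show False using only[OF c(1)] c(2)[of x] x True by simp
  qed
  then show ?thesis using x matching_singleton by (intro exI[of _ "{{v, x}}"]) simp
next
  case False
  define F where "F = {e \<in> E. e \<subseteq> nbrs v}"
  \<comment> \<open>The locale is used a second time, for the graph induced on the neighbours of
    \<open>v\<close>.\<close>
  interpret H: finite_graph "nbrs v" F
    by unfold_locales (use nbrs_subset edge_card in \<open>auto simp: F_def\<close>)
  have "F \<inter> inc v = {}" unfolding F_def inc_def using not_in_nbrs by blast
  moreover have "F \<union> inc v \<subseteq> E" unfolding F_def inc_def by blast
  ultimately have "card F + deg v \<le> card E"
    unfolding deg_def using finite_E finite_inc H.finite_E
    by (metis card_Un_disjoint card_mono)
  then have "\<exists>S\<subseteq>nbrs v. H.isolable S \<and> card (nbrs v) \<le> card S + 2 * n"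
    using H.ex_isolable[OF n] False v E unfolding deg_eq_card_nbrs by fastforce
  then obtain S x where S: "S \<subseteq> nbrs v" "card (nbrs v) \<le> card S + 2 * n"
    and x: "x \<in> nbrs v - S" "matching {e \<in> F. e \<inter> S \<noteq> {} \<and> x \<notin> e}"
    unfolding H.isolable_def by blast
  define M where "M = {{v, x}} \<union> {e \<in> F. e \<inter> S \<noteq> {} \<and> x \<notin> e}"
  have "matching M"
    unfolding M_def
  proof (rule matching_Un[OF matching_singleton x(2)])
    have "v \<notin> e" if "e \<in> F" for e using that not_in_nbrs unfolding F_def by blast
    then show "\<Union>{{v, x}} \<inter> \<Union>{e \<in> F. e \<inter> S \<noteq> {} \<and> x \<notin> e} = {}" by auto
  qed
  moreover have vx: "{v, x} \<in> E" using x unfolding nbrs_def by blast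
  then have "M \<subseteq> E" unfolding M_def F_def by blast
  moreover have "\<not> has_fan n (E - M)"
  proof
    assume "has_fan n (E - M)"
    then obtain c K where K: "K \<subseteq> E - M" "\<forall>w\<in>\<Union>K. {c, w} \<in> E - M"
      "card (\<Union>K) = 2 * n" "\<Union>K \<subseteq> nbrs c" "2 * n \<le> deg c"
      using n by (elim fan_centreE) auto
    have c: "c = v" using only K by blast
    have xK: "x \<notin> \<Union>K" using K(2) c unfolding M_def by blast
    have "w \<notin> S" if w: "w \<in> \<Union>K" for w
    proof
      assume "w \<in> S"
      obtain e where e: "e \<in> K" "w \<in> e" using w by blast
      then have "e \<in> F" using K(1,4) c unfolding F_def by blast
      moreover have "x \<notin> e" using xK e by blast
      ultimately have "e \<in> M" using \<open>w \<in> S\<close> e unfolding M_def by blast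
      then show False using K(1) e by blast
    qed
    then have sub: "\<Union>K \<subseteq> nbrs v - insert x S" using K(4) c xK by blast
    then have "2 * n \<le> card (nbrs v - insert x S)"
      using card_mono[OF _ sub] nbrs_subset(2) K(3) by simp
    also have "\<dots> = card (nbrs v) - Suc (card S)"
    proof -
      have "finite S" using S nbrs_subset(2) finite_subset by blast
      then show ?thesis using S x by (simp add: card_Diff_subset)
    qed
    finally show False using S n by simp
  qed
  ultimately show ?thesis by blast
qed

lemma fan_lower_bound:
  assumes n: "n \<ge> 2" and E: "card E \<le> 4 * n + 4" "odd n \<Longrightarrow> card E \<le> 4 * n + 3"
    "n = 2 \<Longrightarrow> card E \<le> 9"
  shows "\<exists>M\<subseteq>E. matching M \<and> \<not> has_fan n (E - M)"
proof -
  \<comment> \<open>\<open>three_centres\<close> allows at most 6n - 3 edges. This follows from 4n +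
    4 for n at least 4 and from 4n + 3 for n = 3. For n = 2 it amounts to 9, which is where that
    case becomes exceptional.\<close>
  have "card E + 3 \<le> 6 * n" if "n \<noteq> 2"
  proof (cases "n = 3")
    case False
    then show ?thesis using that n E(1) by simp
  qed (use E(2) in simp)
  then have E3: "card E + 3 \<le> 6 * n" using E(3) by fastforce
  consider u v w where "u \<noteq> v" "u \<noteq> w" "v \<noteq> w" "2 * n \<le> deg u" "2 * n \<le> deg v" "2 * n \<le> deg w"
    | u v where "u \<noteq> v" "2 * n \<le> deg u" "2 * n \<le> deg v" "\<And>c. 2 * n \<le> deg c \<Longrightarrow> c = u \<or> c = v"
    | v where "2 * n \<le> deg v" "\<And>c. 2 * n \<le> deg c \<Longrightarrow> c = v"
    | "\<And>c. \<not> 2 * n \<le> deg c"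
    by metis
  then show ?thesis
  proof cases
    case 1
    then show ?thesis using three_centres n E3 by blast
  next
    case 2
    then show ?thesis using two_centres[of n u v] n E3 by simp
  next
    case 3
    then show ?thesis using one_centre n E(1,2) by blast
  next
    case 4
    have "\<not> has_fan n (E - {})"
    proof
      assume "has_fan n (E - {})"
      then obtain c where "2 * n \<le> deg c" using n by (elim fan_centreE) auto
      then show False using 4 by blast
    qed
    then show ?thesis by (intro exI[of _ "{}"]) (simp add: matching_def)
  qed
qed

section \<open>The case n = 1: destroying all triangles\<close>

lemma has_fan_1D:
  assumes "has_fan 1 F" "F \<subseteq> E"
  obtains a b c where "{a, b} \<in> F" "{a, c} \<in> F" "{b, c} \<in> F" "a \<noteq> b" "a \<noteq> c" "b \<noteq> c"
proof -
  obtain c K where K: "K \<subseteq> F" "card K = 1" "c \<notin> \<Union>K" "\<forall>w\<in>\<Union>K. {c, w} \<in> F"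
    using assms unfolding has_fan_def by blast
  then obtain e where e: "K = {e}" by (auto simp: card_1_singleton_iff)
  then have "card e = 2" using K(1) assms(2) by (auto intro: edge_card)
  then obtain a b where ab: "e = {a, b}" "a \<noteq> b" by (auto simp: card_2_iff)
  show ?thesis by (rule that[of a b c]) (use K e ab in \<open>auto simp: insert_commute\<close>)
qed

text \<open>In a maximum cut every vertex has at most half of its edges inside its own side, so here the
  edges inside the sides form a matching whose complement is bipartite.\<close>

lemma triangle_free_max_deg_3:
  assumes deg3: "\<And>v. deg v \<le> 3"
  shows "\<exists>M\<subseteq>E. matching M \<and> \<not> has_fan 1 (E - M)"
proof -
  define mono where "mono A = {e \<in> E. e \<subseteq> A \<or> e \<inter> A = {}}" for A
  obtain A where A: "\<And>B. card (mono A) \<le> card (mono B)"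
    using ex_has_least_nat[of "\<lambda>_. True" _ "\<lambda>A. card (mono A)"] by blast
  have mono_iff: "{p, q} \<in> mono B \<longleftrightarrow> {p, q} \<in> E \<and> (p \<in> B \<longleftrightarrow> q \<in> B)" for p q B
    unfolding mono_def by auto
  have fin: "finite (mono B)" for B unfolding mono_def using finite_E by simp
  have "matching (mono A)"
    unfolding matching_def
  proof (intro ballI impI, rule ccontr)
    fix e f assume ef: "e \<in> mono A" "f \<in> mono A" "e \<inter> f \<noteq> {}" "e \<noteq> f"
    then obtain v where v: "v \<in> e" "v \<in> f" by blast
    \<comment> \<open>Moving \<open>v\<close> to the other side exchanges the edges at
      \<open>v\<close> inside the sides with those across. At least two of at most three are inside,
      so their number drops, against minimality.\<close>
    define B where "B = (if v \<in> A then A - {v} else insert v A)"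
    have "g \<in> mono B \<longleftrightarrow> g \<in> (mono A - inc v) \<union> (inc v - mono A)" if g: "g \<in> E" for g
    proof (cases "v \<in> g")
      case True
      then obtain w where w: "g = {v, w}" "w \<noteq> v" using g by (meson edgeE)
      then show ?thesis using g by (auto simp: mono_iff B_def inc_def)
    next
      case False
      then show ?thesis using g unfolding mono_def B_def inc_def by auto
    qed
    moreover have "mono B \<subseteq> E" "(mono A - inc v) \<union> (inc v - mono A) \<subseteq> E"
      unfolding mono_def inc_def by auto
    ultimately have "mono B = (mono A - inc v) \<union> (inc v - mono A)" by blast
    then have "card (mono B) \<le> card (mono A - inc v) + card (inc v - mono A)"
      by (simp add: card_Un_le)
    moreover have "card (mono A - inc v) = card (mono A) - card (mono A \<inter> inc v)"
      using fin finite_inc by (simp add: card_Diff_subset_Int)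
    moreover have "card (inc v - mono A) = deg v - card (mono A \<inter> inc v)"
      using fin finite_inc unfolding deg_def by (simp add: card_Diff_subset_Int Int_commute)
    moreover have "card (mono A \<inter> inc v) \<le> card (mono A)" using fin by (simp add: card_mono)
    moreover have "2 \<le> card (mono A \<inter> inc v)"
    proof -
      have "{e, f} \<subseteq> mono A \<inter> inc v" using ef v unfolding mono_def inc_def by auto
      then have "card {e, f} \<le> card (mono A \<inter> inc v)" using fin by (intro card_mono) auto
      then show ?thesis using ef by simp
    qed
    ultimately show False using A[of B] deg3[of v] by linarith
  qed
  moreover have "mono A \<subseteq> E" unfolding mono_def by auto
  moreover have "\<not> has_fan 1 (E - mono A)"
  proof
    assume "has_fan 1 (E - mono A)"
    then obtain a b c where "{a, b} \<in> E - mono A" "{a, c} \<in> E - mono A" "{b, c} \<in> E - mono A"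
      by (rule has_fan_1D) auto
    \<comment> \<open>Two of any three vertices are on the same side.\<close>
    then show False by (auto simp: mono_iff)
  qed
  ultimately show ?thesis by blast
qed

text \<open>At most three edges, those of \<open>H\<close>, avoid \<open>v\<close>; those in
  \<open>N\<close> form triangles with \<open>v\<close>. If \<open>N\<close> is a matching, it
  becomes red, or one edge of \<open>H\<close> if \<open>N\<close> is empty, and at most two blue
  edges of \<open>H\<close> remain. Otherwise two edges of \<open>N\<close> meet in some
  \<open>x\<close>: with \<open>{v, x}\<close> and the at most one edge of \<open>H\<close> avoiding
  \<open>x\<close> red, all blue edges of \<open>H\<close> pass through \<open>x\<close>, which has
  no blue edge to \<open>v\<close>.\<close>

lemma triangle_free_deg_4:
  assumes E: "card E \<le> 7" and v: "4 \<le> deg v"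
  shows "\<exists>M\<subseteq>E. matching M \<and> \<not> has_fan 1 (E - M)"
proof -
  define H where "H = {e \<in> E. v \<notin> e}"
  define N where "N = {e \<in> H. e \<subseteq> nbrs v}"
  have finH: "finite H" unfolding H_def using finite_E by simp
  have "H = E - inc v" unfolding H_def inc_def by auto
  moreover have "card (E - inc v) = card E - deg v"
    unfolding deg_def using finite_inc by (intro card_Diff_subset) (auto simp: inc_def)
  ultimately have H3: "card H \<le> 3" using E v by simp
  have cases: False if "has_fan 1 (E - M)"
    and base: "\<And>p q. {p, q} \<in> N - M \<Longrightarrow> {v, p} \<in> E - M \<Longrightarrow> {v, q} \<in> E - M \<Longrightarrow> False"
    and tri: "\<And>p q r. {p, q} \<in> H - M \<Longrightarrow> {p, r} \<in> H - M \<Longrightarrow> {q, r} \<in> H - M \<Longrightarrow>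
      p \<noteq> q \<Longrightarrow> p \<noteq> r \<Longrightarrow> q \<noteq> r \<Longrightarrow> False" for M
  proof -
    obtain a b c where abc: "{a, b} \<in> E - M" "{a, c} \<in> E - M" "{b, c} \<in> E - M" "a \<noteq> b" "a \<noteq> c" "b \<noteq> c"
      using has_fan_1D[OF \<open>has_fan 1 (E - M)\<close>] by blast
    have base': False if "{p, q} \<in> E - M" "{v, p} \<in> E - M" "{v, q} \<in> E - M" "p \<noteq> v" "q \<noteq> v" for p q
      using base[of p q] that unfolding N_def H_def nbrs_def by simp
    consider "v = a" | "v = b" | "v = c" | "v \<noteq> a" "v \<noteq> b" "v \<noteq> c" by blast
    then show False
    proof cases
      case 1
      then show False using base'[of b c] abc by simp
    next
      case 2
      then show False using base'[of a c] abc by (simp add: insert_commute)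
    next
      case 3
      then show False using base'[of a b] abc by (simp add: insert_commute)
    next
      case 4
      then show False using tri[of a b c] abc unfolding H_def by simp
    qed
  qed
  show ?thesis
  proof (cases "matching N")
    case True
    obtain M where M: "N \<subseteq> M" "M \<subseteq> H" "matching M" "H \<noteq> {} \<Longrightarrow> M \<noteq> {}"
    proof (cases "N = {} \<and> H \<noteq> {}")
      case True
      then obtain e where "e \<in> H" by blast
      then show ?thesis using that[of "{e}"] True matching_singleton by auto
    next
      case False
      then show ?thesis using that[of N] \<open>matching N\<close> unfolding N_def by blast
    qed
    have "\<not> has_fan 1 (E - M)"
    proof
      assume "has_fan 1 (E - M)"
      then show False
      proof (rule cases)
        show False if "{p, q} \<in> N - M" for p q using that M by blast
        fix p q r assume pqr: "{p, q} \<in> H - M" "{p, r} \<in> H - M" "{q, r} \<in> H - M" "p \<noteq> q" "p \<noteq> r" "q \<noteq> r"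
        then have "card {{p, q}, {p, r}, {q, r}} = 3" by (auto simp: doubleton_eq_iff)
        moreover have "card {{p, q}, {p, r}, {q, r}} \<le> card (H - M)"
          using pqr finH by (intro card_mono) auto
        moreover have "M \<noteq> {}" using M pqr by blast
        then have "H - M \<subset> H" using M by blast
        then have "card (H - M) < card H" using finH psubset_card_mono by blast
        ultimately show False using H3 by simp
      qed
    qed
    moreover have "M \<subseteq> E" using M unfolding H_def by blast
    ultimately show ?thesis using M by blast
  next
    case False
    then obtain e f x where ef: "e \<in> N" "f \<in> N" "x \<in> e" "x \<in> f" "e \<noteq> f" unfolding matching_def by blast
    then have x: "{v, x} \<in> E" unfolding N_def nbrs_def by blast
    have sub: "{g \<in> H. x \<notin> g} \<subseteq> H - {e, f}" using ef by auto
    have "card (H - {e, f}) \<le> 1"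
      using ef finH H3 unfolding N_def by (simp add: card_Diff_subset)
    then have m: "matching {g \<in> H. x \<notin> g}"
      using matching_if_card_le_1[of "H - {e, f}"] finH matching_subset[OF _ sub] by blast
    define M where "M = {{v, x}} \<union> {g \<in> H. x \<notin> g}"
    have "matching M" unfolding M_def
      by (rule matching_Un[OF matching_singleton m]) (auto simp: H_def)
    moreover have "M \<subseteq> E" using x unfolding M_def H_def by auto
    moreover have "\<not> has_fan 1 (E - M)"
    proof
      assume "has_fan 1 (E - M)"
      then show False
      proof (rule cases)
        show False if "{p, q} \<in> N - M" "{v, p} \<in> E - M" "{v, q} \<in> E - M" for p q
          using that unfolding M_def N_def by auto
        show False if "{p, q} \<in> H - M" "{p, r} \<in> H - M" "{q, r} \<in> H - M"
          "p \<noteq> q" "p \<noteq> r" "q \<noteq> r" for p q r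
          using that unfolding M_def by auto
      qed
    qed
    ultimately show ?thesis by blast
  qed
qed

lemma triangle_lower_bound:
  assumes "card E \<le> 7"
  shows "\<exists>M\<subseteq>E. matching M \<and> \<not> has_fan 1 (E - M)"
proof (cases "\<exists>v. 4 \<le> deg v")
  case True
  then show ?thesis using triangle_free_deg_4 assms by blast
next
  case False
  then have "deg v \<le> 3" for v by (simp add: not_le less_Suc_eq_le numeral_eq_Suc)
  then show ?thesis by (rule triangle_free_max_deg_3)
qed

end

section \<open>The value of the size Ramsey number\<close>

lemma arrows_card_ge:
  assumes G: "simple_graph G" and n: "n > 0" and arr: "arrows G (path_graph 3) (fan_graph n)"
  shows "(if n = 2 then 10 else if odd n then 4 * n + 4 else 4 * n + 5) \<le> card (edges G)"
proof (rule ccontr)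
  assume less: "\<not> ?thesis"
  interpret finite_graph "verts G" "edges G"
    using G unfolding simple_graph_def by unfold_locales auto
  have "\<exists>M\<subseteq>edges G. matching M \<and> \<not> has_fan n (edges G - M)"
  proof (cases "n = 1")
    case True
    then show ?thesis using triangle_lower_bound less by simp
  next
    case False
    then show ?thesis using n less by (intro fan_lower_bound) (auto split: if_splits)
  qed
  then show False using arr arrows_iff[OF G n] by blast
qed

theorem theorem4:
  fixes n :: nat
  assumes "n > 0"
  shows "size_ramsey (path_graph 3) (fan_graph n) =
           (if n = 2 then 10 else if odd n then 4 * n + 4 else 4 * n + 5)"
  unfolding size_ramsey_def
proof (rule Least_equality)
  obtain G :: "nat graph" where G: "simple_graph G" "arrows G (path_graph 3) (fan_graph n)"
    and le: "card (edges G) \<le> (if n = 2 then 10 else if odd n then 4 * n + 4 else 4 * n + 5)"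
    using fan_upper_bound[OF assms] by (elim exE conjE)
  have "card (edges G) = (if n = 2 then 10 else if odd n then 4 * n + 4 else 4 * n + 5)"
    using le arrows_card_ge[OF G(1) assms G(2)] by (rule antisym)
  then show "0 < (if n = 2 then 10 else if odd n then 4 * n + 4 else 4 * n + 5) \<and>
    (\<exists>G :: nat graph. simple_graph G \<and>
      card (edges G) = (if n = 2 then 10 else if odd n then 4 * n + 4 else 4 * n + 5) \<and>
      arrows G (path_graph 3) (fan_graph n))"
    using G by (intro conjI exI[of _ G]) auto
qed (use arrows_card_ge[OF _ assms] in blast)

end
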